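(* Fix $\beta_1,\beta_2,\beta_3\in\mathbb R$. For $\beta_4\in\mathbb R$ and $\mathbf W\in\mathcal W_3$ let $T(\mathbf W)=\sum_{a=1}^3\beta_a\int_{[0,1]^2}W_a(x,y)\,dx\,dy+\beta_4t_{\mathrm{rb}\triangle}(\mathbf W)$, and let $$\psi_{\mathrm{rb}\triangle}(\beta_4)=\sup_{\widetilde{\mathbf W}\in\widetilde{\mathcal W}_3}\Big\{T(\mathbf W)-\tfrac12\mathcal I(\mathbf W)\Big\},\qquad \mathcal M^*_{\mathrm{rb}\triangle}(\beta_4)=\operatorname*{arg\,max}_{\widetilde{\mathbf W}\in\widetilde{\mathcal W}_3}\Big\{T(\mathbf W)-\tfrac12\mathcal I(\mathbf W)\Big\}.$$ For $1\le a<b\le3$ let $\mathbf W^{(ab)}\in\mathcal W_3$ be the constant graphon with $W^{(ab)}_a\equiv\frac{e^{2\beta_a}}{e^{2\beta_a}+e^{2\beta_b}}$, $W^{(ab)}_b\equiv\frac{e^{2\beta_b}}{e^{2\beta_a}+e^{2\beta_b}}$, and $W^{(ab)}_c\equiv0$ for $c\notin\{a,b\}$. Define $\mathcal N^*_{\mathrm{rb}\triangle}=\{\widetilde{\mathbf W}^{(ab)}:(a,b)\in\mathcal P_*\}$, where $\mathcal P_*=\operatorname*{arg\,max}_{1\le a<b\le3}(e^{2\beta_a}+e^{2\beta_b})$. Then $$\lim_{\beta_4\to-\infty}\ \sup_{\widetilde{\mathbf W}\in\mathcal M^*_{\mathrm{rb}\triangle}(\beta_4)}\delta_\square(\widetilde{\mathbf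 W},\mathcal N^*_{\mathrm{rb}\triangle})=0,$$ and $$\lim_{\beta_4\to-\infty}\psi_{\mathrm{rb}\triangle}(\beta_4)=\frac12\log\Big(\max_{1\le a<b\le3}\big(e^{2\beta_a}+e^{2\beta_b}\big)\Big).$$
   Context: $\Delta_3=\{\mu\in[0,1]^3:\mu_1+\mu_2+\mu_3=1\}$. A $3$-colored probability graphon is a measurable symmetric map $\mathbf W=(W_1,W_2,W_3):[0,1]^2\to\Delta_3$; $\mathcal W_3$ is the set of these. For bounded measurable $U$ on $[0,1]^2$, $\|U\|_\square=\sup_{S,T\subset[0,1]}|\int_{S\times T}U|$; $\|\mathbf U\|_\square=\sum_a\|U_a\|_\square$; $\delta_\square(\mathbf U,\mathbf W)=\inf_\phi\|\mathbf U-\mathbf W^\phi\|_\square$ over measure-preserving bijections $\phi$ of $[0,1]$, $\mathbf W^\phi(x,y)=\mathbf W(\phi(x),\phi(y))$. $\widetilde{\mathcal W}_3$ is the quotient of $\mathcal W_3$ by $\delta_\square=0$; $\widetilde{\mathbf W}$ is the class of $\mathbf W$; $\delta_\square(\widetilde{\mathbf W},A)=\inf_{\widetilde{\mathbf U}\in A}\delta_\square(\widetilde{\mathbf W},\widetilde{\mathbf U})$. All functionals used depend only on the class. $t_{\mathrm{rb}\triangle}(\mathbf W)=\int_{[0,1]^3}W_1(x,y)W_2(y,z)W_3(z,x)\,dx\,dy\,dz$; $\mathcal I(\mathbf W)=\sum_{a=1}^3\int_{[0,1]^2}W_a\log W_a\,dx\,dy$, $0\log0=0$. *)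

theory Defs
  imports "HOL-Analysis.Analysis"
begin

text \<open>
  Colors are the elements of the three-element type \<open>3\<close>, where \<open>3 = 0\<close>; its order is not used.
  Functions on \<open>[0,1]\<^sup>2\<close> are total on \<open>\<real>\<^sup>2\<close>; nothing below depends on their values outside the
  unit square.  ``Measurable'' means Borel measurable.
\<close>

definition simplex3 :: "(real ^ 3) set" where
  "simplex3 = {\<mu>. (\<forall>a. \<mu> $ a \<in> {0..1}) \<and> \<mu> $ 1 + \<mu> $ 2 + \<mu> $ 3 = 1}"

type_synonym kernel = "real \<Rightarrow> real \<Rightarrow> real"
type_synonym kernel3 = "real \<Rightarrow> real \<Rightarrow> real ^ 3"

definition graphons :: "kernel3 set" where
  "graphons = {W.
     (\<lambda>(x, y). W x y) \<in> borel_measurable (restrict_space borel ({0..1} \<times> {0..1})) \<and>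
     (\<forall>x\<in>{0..1}. \<forall>y\<in>{0..1}. W x y \<in> simplex3 \<and> W x y = W y x)}"

definition square_integral :: "kernel \<Rightarrow> real" where
  "square_integral U = set_lebesgue_integral lborel ({0..1} \<times> {0..1}) (\<lambda>(x, y). U x y)"

definition cut_norm :: "kernel \<Rightarrow> real" where
  "cut_norm U =
     (SUP (S, T) \<in> {(S, T). S \<in> sets borel \<and> T \<in> sets borel \<and> S \<subseteq> {0..1} \<and> T \<subseteq> {0..1}}.
        \<bar>set_lebesgue_integral lborel (S \<times> T) (\<lambda>(x, y). U x y)\<bar>)"

definition cut_norm3 :: "kernel3 \<Rightarrow> real" where
  "cut_norm3 U = (\<Sum>a\<in>UNIV. cut_norm (\<lambda>x y. U x y $ a))"

abbreviation unit_measure :: "real measure" where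
  "unit_measure \<equiv> restrict_space lborel {0..1}"

text \<open>
  Measurability of the inverse is part of being an automorphism of the measure space \<open>[0,1]\<close>;
  for a Borel bijection it is automatic by the Lusin--Souslin theorem.
\<close>

definition mp_bijections :: "(real \<Rightarrow> real) set" where
  "mp_bijections = {\<phi>. bij_betw \<phi> {0..1} {0..1} \<and>
     \<phi> \<in> measurable unit_measure unit_measure \<and>
     the_inv_into {0..1} \<phi> \<in> measurable unit_measure unit_measure \<and>
     distr unit_measure unit_measure \<phi> = unit_measure}"

definition cut_dist :: "kernel3 \<Rightarrow> kernel3 \<Rightarrow> real" where
  "cut_dist U W = (INF \<phi>\<in>mp_bijections. cut_norm3 (\<lambda>x y. U x y - W (\<phi> x) (\<phi> y)))"

definition cut_rel :: "(kernel3 \<times> kernel3) set" where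
  "cut_rel = {(U, W). U \<in> graphons \<and> W \<in> graphons \<and> cut_dist U W = 0}"

definition graphon_classes :: "kernel3 set set" where
  "graphon_classes = graphons // cut_rel"

definition graphon_class :: "kernel3 \<Rightarrow> kernel3 set" where
  "graphon_class W = cut_rel `` {W}"

text \<open>
  A functional of graphons that is invariant under \<open>cut_rel\<close> (as all those below are) is
  evaluated on a class at an arbitrary representative.
\<close>

definition rep :: "kernel3 set \<Rightarrow> kernel3" where
  "rep C = (SOME W. W \<in> C)"

definition class_dist :: "kernel3 set \<Rightarrow> kernel3 set \<Rightarrow> real" where
  "class_dist C D = cut_dist (rep C) (rep D)"

definition class_set_dist :: "kernel3 set \<Rightarrow> kernel3 set set \<Rightarrow> real" where
  "class_set_dist C A = (INF D\<in>A. class_dist C D)"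

definition rainbow_density :: "kernel3 \<Rightarrow> real" where
  "rainbow_density W =
     set_lebesgue_integral lborel ({0..1} \<times> {0..1} \<times> {0..1})
       (\<lambda>(x, y, z). W x y $ 1 * W y z $ 2 * W z x $ 3)"

text \<open>The convention \<open>0 log 0 = 0\<close> holds for the term \<open>w * ln w\<close>.\<close>

definition entropy_fun :: "kernel3 \<Rightarrow> real" where
  "entropy_fun W = (\<Sum>a\<in>UNIV. square_integral (\<lambda>x y. W x y $ a * ln (W x y $ a)))"

definition hamiltonian :: "real ^ 3 \<Rightarrow> real \<Rightarrow> kernel3 \<Rightarrow> real" where
  "hamiltonian \<beta> \<beta>4 W =
     (\<Sum>a\<in>UNIV. \<beta> $ a * square_integral (\<lambda>x y. W x y $ a)) + \<beta>4 * rainbow_density W"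

definition objective :: "real ^ 3 \<Rightarrow> real \<Rightarrow> kernel3 set \<Rightarrow> real" where
  "objective \<beta> \<beta>4 C = hamiltonian \<beta> \<beta>4 (rep C) - 1 / 2 * entropy_fun (rep C)"

definition psi_rainbow :: "real ^ 3 \<Rightarrow> real \<Rightarrow> real" where
  "psi_rainbow \<beta> \<beta>4 = (SUP C\<in>graphon_classes. objective \<beta> \<beta>4 C)"

definition maximizers :: "real ^ 3 \<Rightarrow> real \<Rightarrow> kernel3 set set" where
  "maximizers \<beta> \<beta>4 = {C. is_arg_max (objective \<beta> \<beta>4) (\<lambda>C. C \<in> graphon_classes) C}"

definition color_pairs :: "(3 \<times> 3) set" where
  "color_pairs = {(1, 2), (1, 3), (2, 3)}"

definition pair_weight :: "real ^ 3 \<Rightarrow> 3 \<times> 3 \<Rightarrow> real" where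
  "pair_weight \<beta> = (\<lambda>(a, b). exp (2 * \<beta> $ a) + exp (2 * \<beta> $ b))"

definition optimal_pairs :: "real ^ 3 \<Rightarrow> (3 \<times> 3) set" where
  "optimal_pairs \<beta> = {p. is_arg_max (pair_weight \<beta>) (\<lambda>p. p \<in> color_pairs) p}"

definition two_color_graphon :: "real ^ 3 \<Rightarrow> 3 \<times> 3 \<Rightarrow> kernel3" where
  "two_color_graphon \<beta> = (\<lambda>(a, b) x y.
     \<chi> c. if c = a \<or> c = b then exp (2 * \<beta> $ c) / (exp (2 * \<beta> $ a) + exp (2 * \<beta> $ b)) else 0)"

definition limit_classes :: "real ^ 3 \<Rightarrow> kernel3 set set" where
  "limit_classes \<beta> = (\<lambda>p. graphon_class (two_color_graphon \<beta> p)) ` optimal_pairs \<beta>"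

end

theory Submission
  imports Defs "HOL-Probability.Probability" "HOL-Real_Asymp.Real_Asymp"
begin

text \<open>
  Averaging over the three edges of a random triangle, six times the functional equals the integral
  over \<open>(x, y, z)\<close> of a function \<open>G\<close> of the three color distributions \<open>P = W x y\<close>, \<open>Q = W y z\<close>,
  \<open>R = W z x\<close>: the sum of their weighted entropies minus \<open>\<kappa> = -\<beta>\<^sub>4\<close> times the permanent of
  \<open>(P, Q, R)\<close>. This reduces everything to \<open>\<Delta>\<^sub>3\<^sup>3\<close>, and compactness of the space of graphons is
  not needed.

  Where the permanent vanishes, Hall's condition and Gibbs' inequality show that the entropy sum is
  at most \<open>3 ln M\<close>, where \<open>M\<close> is the largest pair weight, with equality only if
  \<open>P = Q = R\<close> is an optimal two-color distribution. By compactness of \<open>\<Delta>\<^sub>3\<^sup>3\<close>, for large \<open>\<kappa>\<close> the maximum of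
  \<open>G\<close> is close to \<open>3 ln M\<close> and near-maximizers are close to such diagonal points; hence a maximizing
  graphon has almost all of its triangles, and therefore almost all of its edges, close to one
  and the same optimal distribution.

  Existence of maximizers has to be shown too, because \<open>SUP\<close> over the empty set is an unspecified
  real. For large \<open>\<kappa>\<close> the maximum of \<open>G\<close> is attained at a diagonal point: at a maximizer the third
  color has exponentially small probability, so strict concavity of the entropy in that
  coordinate beats the indefinite quadratic part of the penalty. Hence a constant graphon is a maximizer.
\<close>

section \<open>Entropy and rainbow penalty of a triple of color distributions\<close>

text \<open>Averaging over triangles loses nothing in the value, because an edge of a uniformly
  random triangle is a uniformly random pair; but the pointwise maximum of \<open>G\<close> ignores
  that the three edge colors come from one graphon. It is therefore only an upper bound, and a
  constant graphon attains it as soon as some maximizing triple has the form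
  \<open>(X, X, X)\<close>. Hence the extra work on diagonal maximizers. The estimates near the
  limit ask for less: a maximizer has value at least \<open>1 / 2 * ln M\<close>, because a
  two-color graphon has no rainbow triangle at all.

  A second obstacle is that functionals of a class are evaluated at an arbitrary representative. The
  upper bound holds for every graphon, so what has to be known about representatives concerns
  constant graphons only: cut distance zero from a constant forces equality almost everywhere. Since
  all limit graphons are constant, closeness in cut distance can also be shown without relabelling,
  by comparing values edge by edge.\<close>

lemma gibbs_pointwise:
  fixes p q :: real
  assumes "0 \<le> p" "0 < q"
  shows "p * (ln q - ln p) \<le> q - p"
    and "p * (ln q - ln p) = q - p \<Longrightarrow> p = q"
proof -
  have *: "p * (ln q - ln p) < q - p" if "p \<noteq> q"
  proof (cases "p = 0")
    case False
    then have p: "0 < p" using assms by simp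
    have "ln (q / p) \<noteq> q / p - 1"
      using ln_eq_minus_one[of "q / p"] p assms that by auto
    moreover have "ln (q / p) \<le> q / p - 1"
      using ln_le_minus_one[of "q / p"] p assms by simp
    ultimately have "p * ln (q / p) < p * (q / p - 1)"
      using p by simp
    also have "p * (q / p - 1) = q - p" using p by (simp add: field_simps)
    finally show ?thesis using p assms by (simp add: ln_div)
  qed (use assms in simp)
  then show "p * (ln q - ln p) \<le> q - p"
    by (cases "p = q") auto
  show "p * (ln q - ln p) = q - p \<Longrightarrow> p = q"
    using * by force
qed

text \<open>The gap between the two sides is the relative entropy of \<open>p\<close> with respect
  to the Gibbs distribution \<open>q i = exp (s i) / Z\<close>. Adding \<open>q i - p i\<close>,
  which sums to zero, makes every summand nonnegative, so equality in the sum forces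
  \<open>p i = q i\<close> for each \<open>i\<close>.\<close>

lemma gibbs_inequality:
  fixes p s :: "'a \<Rightarrow> real"
  assumes fin: "finite A" and p: "\<And>i. i \<in> A \<Longrightarrow> 0 \<le> p i" and sum1: "(\<Sum>i\<in>A. p i) = 1"
  shows "(\<Sum>i\<in>A. s i * p i - p i * ln (p i)) \<le> ln (\<Sum>i\<in>A. exp (s i))"
    and "(\<Sum>i\<in>A. s i * p i - p i * ln (p i)) = ln (\<Sum>i\<in>A. exp (s i)) \<Longrightarrow>
      i \<in> A \<Longrightarrow> p i = exp (s i) / (\<Sum>i\<in>A. exp (s i))"
proof -
  define Z where "Z = (\<Sum>i\<in>A. exp (s i))"
  have ne: "A \<noteq> {}" using sum1 by auto
  then have Z: "Z > 0" unfolding Z_def using fin by (intro sum_pos) auto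
  define q where "q i = exp (s i) / Z" for i
  have q: "q i > 0" for i using Z by (simp add: q_def)
  have sq: "(\<Sum>i\<in>A. q i) = 1" using Z by (simp add: q_def Z_def flip: sum_divide_distrib)
  have lq: "ln (q i) = s i - ln Z" for i using Z by (simp add: q_def ln_div)
  have eq: "(\<Sum>i\<in>A. s i * p i - p i * ln (p i)) = ln Z - (\<Sum>i\<in>A. (q i - p i) - p i * (ln (q i) - ln (p i)))"
  proof -
    have "(\<Sum>i\<in>A. (q i - p i) - p i * (ln (q i) - ln (p i)))
        = (\<Sum>i\<in>A. q i) - (\<Sum>i\<in>A. p i) - (\<Sum>i\<in>A. s i * p i - p i * ln (p i)) + (\<Sum>i\<in>A. p i * ln Z)"
      by (simp add: lq sum.distrib[symmetric] sum_subtractf[symmetric] algebra_simps)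
    then show ?thesis using sq sum1 by (simp flip: sum_distrib_right)
  qed
  have nn: "0 \<le> (q i - p i) - p i * (ln (q i) - ln (p i))" if "i \<in> A" for i
    using gibbs_pointwise(1)[OF p[OF that] q[of i]] by simp
  then have "0 \<le> (\<Sum>i\<in>A. (q i - p i) - p i * (ln (q i) - ln (p i)))" by (rule sum_nonneg)
  then show "(\<Sum>i\<in>A. s i * p i - p i * ln (p i)) \<le> ln (\<Sum>i\<in>A. exp (s i))"
    using eq by (simp add: Z_def)
  show "p i = exp (s i) / (\<Sum>i\<in>A. exp (s i))"
    if "(\<Sum>i\<in>A. s i * p i - p i * ln (p i)) = ln (\<Sum>i\<in>A. exp (s i))" "i \<in> A"
  proof -
    have "(\<Sum>i\<in>A. (q i - p i) - p i * (ln (q i) - ln (p i))) = 0"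
      using eq that by (simp add: Z_def)
    then have "(q i - p i) - p i * (ln (q i) - ln (p i)) = 0"
      using sum_nonneg_eq_0_iff[OF fin, of "\<lambda>i. (q i - p i) - p i * (ln (q i) - ln (p i))"] nn that by blast
    then show ?thesis
      using gibbs_pointwise(2)[OF p[OF that(2)] q[of i]] by (simp add: q_def Z_def)
  qed
qed

section \<open>Continuity and strong convexity of \<open>x * ln x\<close>\<close>

text \<open>From \<open>ln y \<le> y - 1\<close> at \<open>y = 1 / sqrt x\<close>. It yields
  continuity at 0 and, later, a uniform bound for the entropy integrand.\<close>

lemma abs_mult_ln_le_sqrt:
  fixes x :: real
  assumes "0 \<le> x" "x \<le> 1"
  shows "\<bar>x * ln x\<bar> \<le> 2 * sqrt x"
proof (cases "x = 0")
  case False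
  then have x: "x > 0" using assms by simp
  have "- ln (sqrt x) \<le> 1 / sqrt x - 1"
    using ln_le_minus_one[of "1 / sqrt x"] x by (simp add: ln_div)
  then have "- ln x \<le> 2 / sqrt x" using x by (simp add: ln_sqrt)
  then have "x * (- ln x) \<le> x * (2 / sqrt x)" using x by (intro mult_left_mono) auto
  also have "\<dots> = 2 * sqrt x" using x by (simp add: field_simps)
  finally show ?thesis using x assms by (simp add: abs_mult)
qed simp

lemma continuous_on_mult_ln: "continuous_on {0..1} (\<lambda>x::real. x * ln x)"
proof -
  have "continuous (at x within {0..1}) (\<lambda>x::real. x * ln x)" if "x \<in> {0..1}" for x :: real
  proof (cases "x = 0")
    case False
    then show ?thesis by (intro continuous_intros) auto
  next
    case True
    have "((\<lambda>x::real. x * ln x) \<longlongrightarrow> 0) (at 0 within {0..1})"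
    proof (rule Lim_null_comparison)
      show "\<forall>\<^sub>F x in at 0 within {0..1}. norm (x * ln x) \<le> 2 * sqrt x"
        by (auto simp: eventually_at_filter intro!: always_eventually abs_mult_ln_le_sqrt)
      have "((\<lambda>x. 2 * sqrt x) \<longlongrightarrow> 2 * sqrt 0) (at 0 within {0..1})"
        by (intro tendsto_intros)
      then show "((\<lambda>x. 2 * sqrt x) \<longlongrightarrow> 0) (at 0 within {0..1})" by simp
    qed
    then show ?thesis using True by (simp add: continuous_within)
  qed
  then show ?thesis by (simp add: continuous_on_eq_continuous_within)
qed

text \<open>Pinsker's inequality for the distribution \<open>((1 - t) / 2, (1 + t) / 2)\<close>
  against a fair coin, with the factor 2 cleared. The difference of the two sides vanishes at 0
  together with its derivative, whose own derivative is nonnegative. The endpoint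
  \<open>t = 1\<close> is separate because \<open>ln (1 - t)\<close> is not differentiable
  there.\<close>

lemma two_point_entropy_ge_square:
  fixes t :: real
  assumes "0 \<le> t" "t \<le> 1"
  shows "t\<^sup>2 \<le> (1 - t) * ln (1 - t) + (1 + t) * ln (1 + t)"
proof (cases "t = 1")
  case True
  then show ?thesis using ln_le_minus_one[of "1 / 2 :: real"] by (simp add: ln_div)
next
  case False
  define g where "g x = (1 - x) * ln (1 - x) + (1 + x) * ln (1 + x) - x\<^sup>2" for x :: real
  have "g 0 \<le> g t"
  proof (rule DERIV_nonneg_imp_nondecreasing[OF assms(1)])
    fix x assume x: "0 \<le> x" "x \<le> t"
    then have x1: "x < 1" using assms False by simp
    have "(g has_real_derivative (- ln (1 - x) + (1 - x) * (- 1 / (1 - x)) +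
        (ln (1 + x) + (1 + x) * (1 / (1 + x))) - 2 * x)) (at x)"
      unfolding g_def using x x1 by (auto intro!: derivative_eq_intros)
    also have "- ln (1 - x) + (1 - x) * (- 1 / (1 - x)) +
        (ln (1 + x) + (1 + x) * (1 / (1 + x))) - 2 * x = ln (1 + x) - ln (1 - x) - 2 * x"
      using x x1 by simp
    finally have "(g has_real_derivative (ln (1 + x) - ln (1 - x) - 2 * x)) (at x)" .
    moreover have "0 \<le> ln (1 + x) - ln (1 - x) - 2 * x"
    proof -
      define k where "k x = ln (1 + x) - ln (1 - x) - 2 * x" for x :: real
      have "k 0 \<le> k x"
      proof (rule DERIV_nonneg_imp_nondecreasing[OF x(1)])
        fix y assume y: "0 \<le> y" "y \<le> x"
        have "(k has_real_derivative (1 / (1 + y) + 1 / (1 - y) - 2)) (at y)"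
          unfolding k_def using y x1 by (auto intro!: derivative_eq_intros)
        moreover have "0 \<le> 1 / (1 + y) + 1 / (1 - y) - 2"
        proof -
          have "1 / (1 + y) + 1 / (1 - y) - 2 = 2 * y\<^sup>2 / ((1 + y) * (1 - y))"
            using y x1 by (simp add: divide_simps) (simp add: algebra_simps power2_eq_square)
          then show ?thesis using y x1 by simp
        qed
        ultimately show "\<exists>z. (k has_real_derivative z) (at y) \<and> 0 \<le> z" by blast
      qed
      then show ?thesis by (simp add: k_def)
    qed
    ultimately show "\<exists>y. (g has_real_derivative y) (at x) \<and> 0 \<le> y" by blast
  qed
  then show ?thesis by (simp add: g_def)
qed

text \<open>The second derivative of \<open>x * ln x\<close> is \<open>1 / x\<close>, at least
  \<open>1 / \<mu>\<close> up to \<open>\<mu>\<close>; this is the resulting midpoint gain. The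
  factor \<open>1 / \<mu>\<close> is the point: the gain becomes huge in a color of tiny
  probability. Dividing by the mean reduces it to the two-point inequality.\<close>

lemma midpoint_entropy_gain:
  fixes p q \<mu> :: real
  assumes "0 \<le> p" "0 \<le> q" "p \<le> \<mu>" "q \<le> \<mu>" "0 < \<mu>"
  shows "(p - q)\<^sup>2 / (4 * \<mu>) \<le> p * ln p + q * ln q - 2 * ((p + q) / 2 * ln ((p + q) / 2))"
proof -
  have *: "(p - q)\<^sup>2 / (4 * \<mu>) \<le> p * ln p + q * ln q - 2 * ((p + q) / 2 * ln ((p + q) / 2))"
    if "0 \<le> p" "p \<le> q" "q \<le> \<mu>" for p q
  proof (cases "q = 0")
    case False
    define m where "m = (p + q) / 2"
    define t where "t = (q - p) / (p + q)"
    have m: "0 < m" "m \<le> \<mu>" using that False by (auto simp: m_def)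
    have t: "0 \<le> t" "t \<le> 1" using that False by (auto simp: t_def field_simps)
    have pq: "p = m * (1 - t)" "q = m * (1 + t)" using that False by (auto simp: m_def t_def field_simps)
    have lnm: "m * x * ln (m * x) = m * (x * ln x) + m * x * ln m" if "0 \<le> x" for x
      using that m by (cases "x = 0") (auto simp: ln_mult algebra_simps)
    have eq: "p * ln p + q * ln q - 2 * (m * ln m) = m * ((1 - t) * ln (1 - t) + (1 + t) * ln (1 + t))"
      unfolding pq using lnm[of "1 - t"] lnm[of "1 + t"] t by (simp add: algebra_simps)
    have "(p - q)\<^sup>2 / (4 * \<mu>) = m * t\<^sup>2 * (m / \<mu>)"
      unfolding pq by (simp add: power2_eq_square algebra_simps)
    also have "\<dots> \<le> m * t\<^sup>2 * 1" using m by (intro mult_left_mono) auto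
    also have "\<dots> \<le> m * ((1 - t) * ln (1 - t) + (1 + t) * ln (1 + t))"
      using two_point_entropy_ge_square[OF t] m by simp
    finally show ?thesis using eq by (simp add: m_def)
  qed (use that in simp)
  show ?thesis
    using *[of p q] *[of q p] assms by (cases "p \<le> q") (auto simp: power2_commute add.commute)
qed

section \<open>The color simplex, entropy and rainbow penalty\<close>

text \<open>Lets later arguments name the colors \<open>a, b, c\<close> with \<open>c\<close> the
  exceptional one, instead of splitting into cases over the three concrete colors.\<close>

lemma sum_color:
  fixes f :: "3 \<Rightarrow> 'a::comm_monoid_add"
  assumes "distinct [a, b, c]"
  shows "(\<Sum>i\<in>UNIV. f i) = f a + f b + f c"
  using exhaust_3[of a] exhaust_3[of b] exhaust_3[of c] assms
  by (auto simp: sum_3 ac_simps)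

lemma simplex3_altdef: "P \<in> simplex3 \<longleftrightarrow> (\<forall>i. 0 \<le> P $ i) \<and> (\<Sum>i\<in>UNIV. P $ i) = 1"
proof -
  have "P $ i \<le> 1" if "\<forall>i. 0 \<le> P $ i" "(\<Sum>i\<in>UNIV. P $ i) = 1" for i
    using that member_le_sum[of i UNIV "\<lambda>i. P $ i"] by auto
  then show ?thesis by (auto simp: simplex3_def sum_3)
qed

lemma simplex3D:
  assumes "P \<in> simplex3"
  shows "0 \<le> P $ i" "P $ i \<le> 1" "(\<Sum>i\<in>UNIV. P $ i) = 1"
  using assms by (auto simp: simplex3_def sum_3)

lemma compact_simplex3: "compact simplex3"
proof (rule compact_eq_bounded_closed[THEN iffD2], intro conjI)
  have "simplex3 \<subseteq> cbox 0 (\<chi> i. 1)"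
    by (auto simp: simplex3_def mem_box_cart)
  then show "bounded simplex3" using bounded_cbox bounded_subset by blast
  have "simplex3 = (\<Inter>i. {P. 0 \<le> P $ i}) \<inter> (\<Inter>i. {P. P $ i \<le> 1}) \<inter> {P. P $ 1 + P $ 2 + P $ 3 = 1}"
    by (auto simp: simplex3_def)
  moreover have "closed \<dots>"
    by (intro closed_Int closed_INT closed_Collect_le closed_Collect_eq ballI continuous_intros)
  ultimately show "closed simplex3" by simp
qed

text \<open>The edge part of the functional, doubled so that the entropy has coefficient 1; hence
  the weights \<open>exp (2 * \<beta> $ i)\<close> in its maximum.\<close>

definition entropy3 :: "real ^ 3 \<Rightarrow> real ^ 3 \<Rightarrow> real" where
  "entropy3 \<beta> P = (\<Sum>i\<in>UNIV. 2 * \<beta> $ i * P $ i - P $ i * ln (P $ i))"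

text \<open>The probability that independent colors drawn from \<open>P\<close>, \<open>Q\<close>,
  \<open>R\<close> are pairwise distinct.\<close>

definition permanent3 :: "real ^ 3 \<Rightarrow> real ^ 3 \<Rightarrow> real ^ 3 \<Rightarrow> real" where
  "permanent3 P Q R =
     P $ 1 * (Q $ 2 * R $ 3 + Q $ 3 * R $ 2) + P $ 2 * (Q $ 1 * R $ 3 + Q $ 3 * R $ 1) +
     P $ 3 * (Q $ 1 * R $ 2 + Q $ 2 * R $ 1)"

definition triple_energy :: "real ^ 3 \<Rightarrow> real \<Rightarrow> real ^ 3 \<Rightarrow> real ^ 3 \<Rightarrow> real ^ 3 \<Rightarrow> real" where
  "triple_energy \<beta> \<kappa> P Q R = entropy3 \<beta> P + entropy3 \<beta> Q + entropy3 \<beta> R - \<kappa> * permanent3 P Q R"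

lemma permanent3_color:
  assumes "distinct [a, b, c]"
  shows "permanent3 P Q R =
     P $ a * (Q $ b * R $ c + Q $ c * R $ b) + P $ b * (Q $ a * R $ c + Q $ c * R $ a) +
     P $ c * (Q $ a * R $ b + Q $ b * R $ a)"
  using exhaust_3[of a] exhaust_3[of b] exhaust_3[of c] assms
  by (auto simp: permanent3_def algebra_simps)

lemma permanent3_commute:
  "permanent3 Q P R = permanent3 P Q R" "permanent3 P R Q = permanent3 P Q R"
  by (simp_all add: permanent3_def algebra_simps)

lemma permanent3_nonneg:
  "P \<in> simplex3 \<Longrightarrow> Q \<in> simplex3 \<Longrightarrow> R \<in> simplex3 \<Longrightarrow> 0 \<le> permanent3 P Q R"
  by (simp add: permanent3_def simplex3D)

lemma permanent3_eq_0_iff: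
  assumes "P \<in> simplex3" "Q \<in> simplex3" "R \<in> simplex3"
  shows "permanent3 P Q R = 0 \<longleftrightarrow>
    (\<forall>a b c. distinct [a, b, c] \<longrightarrow> P $ a = 0 \<or> Q $ b = 0 \<or> R $ c = 0)"
    (is "_ \<longleftrightarrow> ?R")
proof
  assume 0: "permanent3 P Q R = 0"
  show ?R
  proof (intro allI impI)
    fix a b c :: 3 assume d: "distinct [a, b, c]"
    have nn: "0 \<le> P $ i * (Q $ j * R $ k)" for i j k using assms by (simp add: simplex3D)
    have "P $ a * (Q $ b * R $ c) + P $ a * (Q $ c * R $ b) + P $ b * (Q $ a * R $ c) +
        P $ b * (Q $ c * R $ a) + P $ c * (Q $ a * R $ b) + P $ c * (Q $ b * R $ a) = 0"
      using 0 unfolding permanent3_color[OF d] by (simp only: distrib_left add.assoc)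
    then have "P $ a * (Q $ b * R $ c) = 0"
      using nn[of a b c] nn[of a c b] nn[of b a c] nn[of b c a] nn[of c a b] nn[of c b a] by linarith
    then show "P $ a = 0 \<or> Q $ b = 0 \<or> R $ c = 0" by simp
  qed
next
  assume R: ?R
  have *: "P $ a * (Q $ b * R $ c) = 0" if "distinct [a, b, c]" for a b c
    using R that by force
  show "permanent3 P Q R = 0"
    unfolding permanent3_def distrib_left by (simp add: * del: mult_eq_0_iff)
qed

lemma entropy3_continuous: "continuous_on simplex3 (entropy3 \<beta>)"
proof -
  have "continuous_on simplex3 (\<lambda>P. (\<lambda>x. x * ln x) (P $ i))" for i :: 3
    by (rule continuous_on_compose2[OF continuous_on_mult_ln])
       (auto intro!: continuous_intros simp: simplex3D)
  then show ?thesis unfolding entropy3_def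
    by (intro continuous_on_sum continuous_on_diff) (auto intro!: continuous_intros)
qed

section \<open>Optimal two-color distributions\<close>

definition max_weight :: "real ^ 3 \<Rightarrow> real" where
  "max_weight \<beta> = Max (pair_weight \<beta> ` color_pairs)"

definition two_color_vec :: "real ^ 3 \<Rightarrow> 3 \<times> 3 \<Rightarrow> real ^ 3" where
  "two_color_vec \<beta> p = two_color_graphon \<beta> p 0 0"

lemma two_color_graphon_eq: "two_color_graphon \<beta> p = (\<lambda>x y. two_color_vec \<beta> p)"
  by (auto simp: two_color_vec_def two_color_graphon_def split: prod.splits)

lemma two_color_vec_nth:
  "two_color_vec \<beta> (a, b) $ i =
    (if i = a \<or> i = b then exp (2 * \<beta> $ i) / (exp (2 * \<beta> $ a) + exp (2 * \<beta> $ b)) else 0)"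
  by (simp add: two_color_vec_def two_color_graphon_def)

lemma finite_color_pairs [simp]: "finite color_pairs" "color_pairs \<noteq> {}"
  by (auto simp: color_pairs_def)

lemma color_pair_third:
  assumes "(a, b) \<in> color_pairs"
  obtains c where "distinct [a, b, c]"
  using assms that[of 1] that[of 2] that[of 3] by (auto simp: color_pairs_def)

lemma color_pair_avoiding:
  fixes c :: 3
  obtains a b where "(a, b) \<in> color_pairs" "distinct [a, b, c]"
  using exhaust_3[of c] by (force simp: color_pairs_def)

lemma pair_weight_le_max_weight: "p \<in> color_pairs \<Longrightarrow> pair_weight \<beta> p \<le> max_weight \<beta>"
  by (simp add: max_weight_def)

lemma add_exp_le_max_weight:
  assumes "a \<noteq> b"
  shows "exp (2 * \<beta> $ a) + exp (2 * \<beta> $ b) \<le> max_weight \<beta>"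
proof -
  have "(a, b) \<in> color_pairs \<or> (b, a) \<in> color_pairs"
    using exhaust_3[of a] exhaust_3[of b] assms by (auto simp: color_pairs_def)
  then show ?thesis
    using pair_weight_le_max_weight[of "(a, b)" \<beta>] pair_weight_le_max_weight[of "(b, a)" \<beta>]
    by (auto simp: pair_weight_def add.commute)
qed

lemma exp_less_max_weight: "exp (2 * \<beta> $ a) < max_weight \<beta>"
proof -
  obtain b where "b \<noteq> a" by (metis zero_neq_one)
  then have "a \<noteq> b" by simp
  then show ?thesis
    using add_exp_le_max_weight[of a b \<beta>] exp_gt_zero[of "2 * \<beta> $ b"] by linarith
qed

lemma optimal_pairs_iff: "p \<in> optimal_pairs \<beta> \<longleftrightarrow> p \<in> color_pairs \<and> pair_weight \<beta> p = max_weight \<beta>"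
proof -
  have "max_weight \<beta> \<in> pair_weight \<beta> ` color_pairs"
    unfolding max_weight_def by (rule Max_in) auto
  then obtain q where "q \<in> color_pairs" "pair_weight \<beta> q = max_weight \<beta>" by force
  then have "(\<forall>y. y \<in> color_pairs \<longrightarrow> pair_weight \<beta> y \<le> pair_weight \<beta> p) \<longleftrightarrow> pair_weight \<beta> p = max_weight \<beta>"
    if "p \<in> color_pairs"
    using pair_weight_le_max_weight[of _ \<beta>] that by (metis order.antisym)
  then show ?thesis by (auto simp: optimal_pairs_def is_arg_max_def not_less)
qed

lemma finite_optimal_pairs: "finite (optimal_pairs \<beta>)"
  by (rule finite_subset[of _ color_pairs]) (auto simp: optimal_pairs_iff)

lemma optimal_pairs_nonempty: "optimal_pairs \<beta> \<noteq> {}"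
proof -
  have "max_weight \<beta> \<in> pair_weight \<beta> ` color_pairs"
    unfolding max_weight_def by (rule Max_in) auto
  then show ?thesis by (force simp: optimal_pairs_iff)
qed

lemma two_color_vec_simplex3:
  assumes "p \<in> color_pairs"
  shows "two_color_vec \<beta> p \<in> simplex3"
proof -
  obtain a b where p: "p = (a, b)" by fastforce
  obtain c where d: "distinct [a, b, c]" using assms color_pair_third p by blast
  have "exp (2 * \<beta> $ a) + exp (2 * \<beta> $ b) > 0" by (simp add: add_pos_pos)
  then show ?thesis
    using d by (auto simp: simplex3_altdef sum_color[OF d] p two_color_vec_nth add_divide_distrib[symmetric])
qed

lemma entropy3_le: "P \<in> simplex3 \<Longrightarrow> entropy3 \<beta> P \<le> ln (\<Sum>i\<in>UNIV. exp (2 * \<beta> $ i))"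
  unfolding entropy3_def by (rule gibbs_inequality(1)) (auto simp: simplex3D)

text \<open>Gibbs' inequality is applied over the two remaining colors only, so the partition
  function is the pair weight; its equality case identifies the distribution.\<close>

lemma entropy3_missing_color:
  assumes P: "P \<in> simplex3" and d: "distinct [a, b, c]" and 0: "P $ c = 0"
  shows "entropy3 \<beta> P \<le> ln (exp (2 * \<beta> $ a) + exp (2 * \<beta> $ b))"
    and "entropy3 \<beta> P = ln (exp (2 * \<beta> $ a) + exp (2 * \<beta> $ b)) \<Longrightarrow> P = two_color_vec \<beta> (a, b)"
proof -
  have ab: "a \<noteq> b" using d by simp
  have s: "(\<Sum>i\<in>{a, b}. f i) = f a + f b" for f :: "3 \<Rightarrow> real" using ab by simp
  have e: "entropy3 \<beta> P = (\<Sum>i\<in>{a, b}. 2 * \<beta> $ i * P $ i - P $ i * ln (P $ i))"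
    unfolding entropy3_def s by (simp add: sum_color[OF d] 0)
  have 1: "(\<Sum>i\<in>{a, b}. P $ i) = 1"
    using simplex3D(3)[OF P] unfolding s by (simp add: sum_color[OF d] 0)
  show "entropy3 \<beta> P \<le> ln (exp (2 * \<beta> $ a) + exp (2 * \<beta> $ b))"
    using gibbs_inequality(1)[OF _ _ 1, of "\<lambda>i. 2 * \<beta> $ i"] simplex3D(1)[OF P] unfolding e s by simp
  assume eq: "entropy3 \<beta> P = ln (exp (2 * \<beta> $ a) + exp (2 * \<beta> $ b))"
  have "P $ i = exp (2 * \<beta> $ i) / (exp (2 * \<beta> $ a) + exp (2 * \<beta> $ b))" if "i \<in> {a, b}" for i
    using gibbs_inequality(2)[OF _ _ 1, of "\<lambda>i. 2 * \<beta> $ i" i] simplex3D(1)[OF P] eq that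
    unfolding e s by blast
  moreover have "i = a \<or> i = b \<or> i = c" for i
    using exhaust_3[of i] exhaust_3[of a] exhaust_3[of b] exhaust_3[of c] d by auto
  ultimately show "P = two_color_vec \<beta> (a, b)"
    using 0 d by (auto simp: vec_eq_iff two_color_vec_nth)
qed

lemma entropy3_two_color_vec:
  assumes "(a, b) \<in> color_pairs"
  shows "entropy3 \<beta> (two_color_vec \<beta> (a, b)) = ln (exp (2 * \<beta> $ a) + exp (2 * \<beta> $ b))"
proof -
  obtain c where d: "distinct [a, b, c]" using assms color_pair_third by blast
  define Z where "Z = exp (2 * \<beta> $ a) + exp (2 * \<beta> $ b)"
  have Z: "Z > 0" by (simp add: Z_def add_pos_pos)
  have l: "ln (exp (2 * \<beta> $ i) / Z) = 2 * \<beta> $ i - ln Z" for i using Z by (simp add: ln_div)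
  have v: "two_color_vec \<beta> (a, b) $ a = exp (2 * \<beta> $ a) / Z"
    "two_color_vec \<beta> (a, b) $ b = exp (2 * \<beta> $ b) / Z" "two_color_vec \<beta> (a, b) $ c = 0"
    using d by (auto simp: two_color_vec_nth Z_def)
  have "entropy3 \<beta> (two_color_vec \<beta> (a, b)) = (exp (2 * \<beta> $ a) / Z + exp (2 * \<beta> $ b) / Z) * ln Z"
  proof -
    have "x * A - A * (x - L) + (y * B - B * (y - L)) = (A + B) * L" for x y A B L :: real
      by (simp add: algebra_simps)
    from this[of "2 * \<beta> $ a" "exp (2 * \<beta> $ a) / Z" "ln Z" "2 * \<beta> $ b" "exp (2 * \<beta> $ b) / Z"]
    show ?thesis unfolding entropy3_def sum_color[OF d] v l by simp
  qed
  also have "exp (2 * \<beta> $ a) / Z + exp (2 * \<beta> $ b) / Z = 1"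
    using Z by (simp add: Z_def add_divide_distrib[symmetric])
  finally show ?thesis by (simp add: Z_def)
qed

lemma triple_energy_two_color_vec:
  assumes "p \<in> optimal_pairs \<beta>"
  shows "triple_energy \<beta> \<kappa> (two_color_vec \<beta> p) (two_color_vec \<beta> p) (two_color_vec \<beta> p) = 3 * ln (max_weight \<beta>)"
proof -
  obtain a b where p: "p = (a, b)" by fastforce
  have ab: "(a, b) \<in> color_pairs" and w: "max_weight \<beta> = exp (2 * \<beta> $ a) + exp (2 * \<beta> $ b)"
    using assms by (auto simp: optimal_pairs_iff p pair_weight_def)
  obtain c where d: "distinct [a, b, c]" using ab color_pair_third by blast
  then have "two_color_vec \<beta> (a, b) $ c = 0" by (auto simp: two_color_vec_nth)
  then show ?thesis
    by (simp add: triple_energy_def p entropy3_two_color_vec[OF ab] w permanent3_color[OF d])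
qed

section \<open>Triples without a rainbow transversal\<close>

text \<open>The propositional content of the Frobenius-Koenig theorem for 3 by 3 matrices. Read
  \<open>p1\<close> as "the first entry of row \<open>P\<close> is zero", and so on. Zeros that meet
  every transversal contain an \<open>s\<close> by \<open>t\<close> zero block with
  \<open>s + t = 4\<close>; zero rows are excluded, which leaves a zero column or a 2 by 2
  block.\<close>

lemma missing_transversal_cases:
  assumes "\<not> p1 \<or> \<not> p2 \<or> \<not> p3" "\<not> q1 \<or> \<not> q2 \<or> \<not> q3" "\<not> r1 \<or> \<not> r2 \<or> \<not> r3"
    "p1 \<or> q2 \<or> r3" "p1 \<or> q3 \<or> r2" "p2 \<or> q1 \<or> r3" "p2 \<or> q3 \<or> r1" "p3 \<or> q1 \<or> r2" "p3 \<or> q2 \<or> r1"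
  shows "(p1 \<and> q1 \<and> r1) \<or> (p2 \<and> q2 \<and> r2) \<or> (p3 \<and> q3 \<and> r3) \<or>
    (p2 \<and> q2 \<and> p3 \<and> q3 \<or> p2 \<and> r2 \<and> p3 \<and> r3 \<or> q2 \<and> r2 \<and> q3 \<and> r3) \<or>
    (p1 \<and> q1 \<and> p3 \<and> q3 \<or> p1 \<and> r1 \<and> p3 \<and> r3 \<or> q1 \<and> r1 \<and> q3 \<and> r3) \<or>
    (p1 \<and> q1 \<and> p2 \<and> q2 \<or> p1 \<and> r1 \<and> p2 \<and> r2 \<or> q1 \<and> r1 \<and> q2 \<and> r2)"
  using assms by (cases p1; cases p2; cases p3; simp; cases q1; cases q2; cases q3; simp)

text \<open>Hall's condition for the supports: without a transversal, either the three supports have a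
  union of size at most two, or two of them are the same singleton.\<close>

lemma permanent3_eq_0_cases:
  assumes P: "P \<in> simplex3" and Q: "Q \<in> simplex3" and R: "R \<in> simplex3" and 0: "permanent3 P Q R = 0"
  shows "(\<exists>c. P $ c = 0 \<and> Q $ c = 0 \<and> R $ c = 0) \<or>
    (\<exists>a. (\<forall>i. i \<noteq> a \<longrightarrow> P $ i = 0 \<and> Q $ i = 0) \<or> (\<forall>i. i \<noteq> a \<longrightarrow> P $ i = 0 \<and> R $ i = 0) \<or>
      (\<forall>i. i \<noteq> a \<longrightarrow> Q $ i = 0 \<and> R $ i = 0))"
proof -
  have ne: "P $ 1 \<noteq> 0 \<or> P $ 2 \<noteq> 0 \<or> P $ 3 \<noteq> 0" "Q $ 1 \<noteq> 0 \<or> Q $ 2 \<noteq> 0 \<or> Q $ 3 \<noteq> 0"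
    "R $ 1 \<noteq> 0 \<or> R $ 2 \<noteq> 0 \<or> R $ 3 \<noteq> 0"
    using simplex3D(3)[OF P] simplex3D(3)[OF Q] simplex3D(3)[OF R] by (auto simp: sum_3)
  have *: "\<forall>a b c. distinct [a, b, c] \<longrightarrow> P $ a = 0 \<or> Q $ b = 0 \<or> R $ c = 0"
    using permanent3_eq_0_iff[OF P Q R] 0 by blast
  have "P $ 1 = 0 \<or> Q $ 2 = 0 \<or> R $ 3 = 0" "P $ 1 = 0 \<or> Q $ 3 = 0 \<or> R $ 2 = 0"
    "P $ 2 = 0 \<or> Q $ 1 = 0 \<or> R $ 3 = 0" "P $ 2 = 0 \<or> Q $ 3 = 0 \<or> R $ 1 = 0"
    "P $ 3 = 0 \<or> Q $ 1 = 0 \<or> R $ 2 = 0" "P $ 3 = 0 \<or> Q $ 2 = 0 \<or> R $ 1 = 0"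
    by (simp_all add: *[rule_format])
  then have *: "(P $ 1 = 0 \<and> Q $ 1 = 0 \<and> R $ 1 = 0) \<or> (P $ 2 = 0 \<and> Q $ 2 = 0 \<and> R $ 2 = 0) \<or>
      (P $ 3 = 0 \<and> Q $ 3 = 0 \<and> R $ 3 = 0) \<or>
      (P $ 2 = 0 \<and> Q $ 2 = 0 \<and> P $ 3 = 0 \<and> Q $ 3 = 0 \<or> P $ 2 = 0 \<and> R $ 2 = 0 \<and> P $ 3 = 0 \<and> R $ 3 = 0 \<or>
        Q $ 2 = 0 \<and> R $ 2 = 0 \<and> Q $ 3 = 0 \<and> R $ 3 = 0) \<or>
      (P $ 1 = 0 \<and> Q $ 1 = 0 \<and> P $ 3 = 0 \<and> Q $ 3 = 0 \<or> P $ 1 = 0 \<and> R $ 1 = 0 \<and> P $ 3 = 0 \<and> R $ 3 = 0 \<or>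
        Q $ 1 = 0 \<and> R $ 1 = 0 \<and> Q $ 3 = 0 \<and> R $ 3 = 0) \<or>
      (P $ 1 = 0 \<and> Q $ 1 = 0 \<and> P $ 2 = 0 \<and> Q $ 2 = 0 \<or> P $ 1 = 0 \<and> R $ 1 = 0 \<and> P $ 2 = 0 \<and> R $ 2 = 0 \<or>
        Q $ 1 = 0 \<and> R $ 1 = 0 \<and> Q $ 2 = 0 \<and> R $ 2 = 0)"
    using ne by (intro missing_transversal_cases)
  have ex3: "(\<exists>i. A i) \<longleftrightarrow> A 1 \<or> A 2 \<or> A 3" for A :: "3 \<Rightarrow> bool"
    using forall_3[of "\<lambda>i. \<not> A i"] by auto
  show ?thesis
    using * unfolding ex3 forall_3 by simp
qed

lemma entropy3_singleton:
  assumes P: "P \<in> simplex3" and 0: "\<And>i. i \<noteq> a \<Longrightarrow> P $ i = 0"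
  shows "entropy3 \<beta> P = 2 * \<beta> $ a"
proof -
  obtain b c where d: "distinct [b, c, a]" using color_pair_avoiding by blast
  have "P $ a = 1" using simplex3D(3)[OF P] d 0 by (simp add: sum_color[OF d])
  then show ?thesis using d 0 by (simp add: entropy3_def sum_color[OF d])
qed

text \<open>The third distribution is free, so it may contribute up to \<open>ln S\<close> with the
  weights of all three colors, and \<open>S\<close> exceeds \<open>M\<close>. The gain is
  outweighed: the claim is \<open>x\<^sup>2 * S < M ^ 3\<close>, where \<open>S + x\<close> is the
  sum of the two pair weights containing \<open>a\<close>, hence at most \<open>2 * M\<close>, and
  \<open>x\<^sup>2 * (2 * M - x) < M ^ 3\<close> for \<open>0 < x < M\<close>.\<close>

lemma two_singletons_suboptimal:
  assumes R: "R \<in> simplex3"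
  shows "4 * \<beta> $ a + entropy3 \<beta> R < 3 * ln (max_weight \<beta>)"
proof -
  obtain b c where d: "distinct [b, c, a]" using color_pair_avoiding by blast
  define x M S where "x = exp (2 * \<beta> $ a)" and "M = max_weight \<beta>" and "S = (\<Sum>i\<in>UNIV. exp (2 * \<beta> $ i))"
  have x: "0 < x" "x < M" using exp_less_max_weight by (auto simp: x_def M_def)
  have S: "S > 0" unfolding S_def by (intro sum_pos) auto
  have "a \<noteq> b" "a \<noteq> c" using d by auto
  then have "S + x \<le> 2 * M"
    using add_exp_le_max_weight[of a b \<beta>] add_exp_le_max_weight[of a c \<beta>]
    by (simp add: S_def x_def M_def sum_color[OF d])
  then have "x\<^sup>2 * S \<le> x\<^sup>2 * (2 * M - x)" by (intro mult_left_mono) auto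
  also have "\<dots> < M ^ 3"
  proof -
    have "M ^ 3 - x\<^sup>2 * (2 * M - x) = (M - x) * (M * (M - x) + x * (2 * M - x))"
      by (simp add: power2_eq_square power3_eq_cube algebra_simps)
    moreover have "0 < M * (M - x) + x * (2 * M - x)" using x by (intro add_pos_pos mult_pos_pos) auto
    ultimately show ?thesis using x by (smt (verit) mult_pos_pos)
  qed
  finally have "ln (x\<^sup>2 * S) < ln (M ^ 3)" using x S by simp
  moreover have "ln (x\<^sup>2 * S) = 4 * \<beta> $ a + ln S"
    using x S by (simp add: ln_mult ln_realpow) (simp add: x_def)
  moreover have "ln (M ^ 3) = 3 * ln M" using x by (simp add: ln_realpow)
  ultimately show ?thesis using entropy3_le[OF R, of \<beta>] by (simp add: S_def M_def)
qed

text \<open>With a common missing color, equality in the total forces equality in each of the three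
  Gibbs bounds, all for the same pair. The case of two equal singletons stays strictly below and
  cannot contribute to equality.\<close>

lemma rainbow_free_triple:
  assumes P: "P \<in> simplex3" and Q: "Q \<in> simplex3" and R: "R \<in> simplex3" and 0: "permanent3 P Q R = 0"
  shows "entropy3 \<beta> P + entropy3 \<beta> Q + entropy3 \<beta> R \<le> 3 * ln (max_weight \<beta>)"
    and "3 * ln (max_weight \<beta>) \<le> entropy3 \<beta> P + entropy3 \<beta> Q + entropy3 \<beta> R \<Longrightarrow>
      \<exists>p\<in>optimal_pairs \<beta>. P = two_color_vec \<beta> p \<and> Q = two_color_vec \<beta> p \<and> R = two_color_vec \<beta> p"
proof -
  let ?H = "entropy3 \<beta> P + entropy3 \<beta> Q + entropy3 \<beta> R"
  let ?c = "\<exists>p\<in>optimal_pairs \<beta>. P = two_color_vec \<beta> p \<and> Q = two_color_vec \<beta> p \<and> R = two_color_vec \<beta> p"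
  have "?H \<le> 3 * ln (max_weight \<beta>) \<and> (3 * ln (max_weight \<beta>) \<le> ?H \<longrightarrow> ?c)"
    using permanent3_eq_0_cases[OF P Q R 0]
  proof
    assume "\<exists>c. P $ c = 0 \<and> Q $ c = 0 \<and> R $ c = 0"
    then obtain c where c: "P $ c = 0" "Q $ c = 0" "R $ c = 0" by blast
    obtain a b where ab: "(a, b) \<in> color_pairs" and d: "distinct [a, b, c]"
      using color_pair_avoiding by blast
    define Z where "Z = exp (2 * \<beta> $ a) + exp (2 * \<beta> $ b)"
    have Z: "0 < Z" "Z \<le> max_weight \<beta>"
      using d add_exp_le_max_weight[of a b \<beta>] by (auto simp: Z_def add_pos_pos)
    then have lZ: "ln Z \<le> ln (max_weight \<beta>)" by simp
    note le = entropy3_missing_color(1)[OF P d c(1), of \<beta>] entropy3_missing_color(1)[OF Q d c(2), of \<beta>]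
      entropy3_missing_color(1)[OF R d c(3), of \<beta>]
    note le = le[folded Z_def]
    have ?c if "3 * ln (max_weight \<beta>) \<le> ?H"
    proof -
      have "ln Z = ln (max_weight \<beta>)" "entropy3 \<beta> P = ln Z" "entropy3 \<beta> Q = ln Z" "entropy3 \<beta> R = ln Z"
        using le lZ that by linarith+
      moreover have "Z = max_weight \<beta>" using \<open>ln Z = _\<close> Z by simp
      ultimately show ?thesis
        using entropy3_missing_color(2)[OF P d c(1), of \<beta>] entropy3_missing_color(2)[OF Q d c(2), of \<beta>]
          entropy3_missing_color(2)[OF R d c(3), of \<beta>] ab
        by (intro bexI[of _ "(a, b)"]) (auto simp: optimal_pairs_iff pair_weight_def Z_def)
    qed
    then show ?thesis using le lZ by auto
  next
    assume "\<exists>a. (\<forall>i. i \<noteq> a \<longrightarrow> P $ i = 0 \<and> Q $ i = 0) \<or> (\<forall>i. i \<noteq> a \<longrightarrow> P $ i = 0 \<and> R $ i = 0) \<or>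
      (\<forall>i. i \<noteq> a \<longrightarrow> Q $ i = 0 \<and> R $ i = 0)"
    then obtain a where "(\<forall>i. i \<noteq> a \<longrightarrow> P $ i = 0 \<and> Q $ i = 0) \<or>
      (\<forall>i. i \<noteq> a \<longrightarrow> P $ i = 0 \<and> R $ i = 0) \<or> (\<forall>i. i \<noteq> a \<longrightarrow> Q $ i = 0 \<and> R $ i = 0)"
      by blast
    then have
      "(entropy3 \<beta> P = 2 * \<beta> $ a \<and> entropy3 \<beta> Q = 2 * \<beta> $ a) \<or>
       (entropy3 \<beta> P = 2 * \<beta> $ a \<and> entropy3 \<beta> R = 2 * \<beta> $ a) \<or>
       (entropy3 \<beta> Q = 2 * \<beta> $ a \<and> entropy3 \<beta> R = 2 * \<beta> $ a)"
      using entropy3_singleton[OF P, of a \<beta>] entropy3_singleton[OF Q, of a \<beta>]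
        entropy3_singleton[OF R, of a \<beta>] by blast
    then have "?H < 3 * ln (max_weight \<beta>)"
      using two_singletons_suboptimal[OF P, of \<beta> a] two_singletons_suboptimal[OF Q, of \<beta> a]
        two_singletons_suboptimal[OF R, of \<beta> a] by linarith
    then show ?thesis by simp
  qed
  then show "?H \<le> 3 * ln (max_weight \<beta>)" "3 * ln (max_weight \<beta>) \<le> ?H \<Longrightarrow> ?c" by blast+
qed

section \<open>Large penalties on a compact set\<close>

text \<open>Off \<open>U\<close>, a point either has positive penalty or has \<open>H\<close> below
  \<open>c\<close>, and by compactness with a uniform margin \<open>m\<close>. A large
  \<open>\<kappa>\<close> disposes of the first kind, the second is already too low. Note the order
  of quantifiers: \<open>\<delta>\<close> does not depend on \<open>\<kappa>\<close>, so later
  tolerances can be chosen relative to \<open>\<delta>\<close> before \<open>\<kappa>\<close>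
  grows.\<close>

lemma compact_penalty:
  fixes H \<rho> :: "'a::metric_space \<Rightarrow> real"
  assumes K: "compact K" and H: "continuous_on K H" and \<rho>: "continuous_on K \<rho>"
    and nonneg: "\<And>z. z \<in> K \<Longrightarrow> 0 \<le> \<rho> z" and U: "open U"
    and sub: "\<And>z. z \<in> K \<Longrightarrow> \<rho> z = 0 \<Longrightarrow> c \<le> H z \<Longrightarrow> z \<in> U"
  shows "\<exists>\<delta>>0. \<forall>\<^sub>F \<kappa> in at_top. \<forall>z\<in>K. c - \<delta> \<le> H z - \<kappa> * \<rho> z \<longrightarrow> z \<in> U"
proof (cases "K - U = {}")
  case True
  then have "z \<in> U" if "z \<in> K" for z using that by blast
  then show ?thesis by (intro exI[of _ 1]) simp
next
  case False
  have KU: "compact (K - U)" using K U by (rule compact_diff)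
  obtain m where m: "m > 0" "\<And>z. z \<in> K - U \<Longrightarrow> m \<le> max (\<rho> z) (c - H z)"
  proof -
    have "continuous_on (K - U) (\<lambda>z. max (\<rho> z) (c - H z))"
      by (intro continuous_intros continuous_on_subset[OF H] continuous_on_subset[OF \<rho>]) auto
    then obtain z where z: "z \<in> K - U" "\<And>y. y \<in> K - U \<Longrightarrow> max (\<rho> z) (c - H z) \<le> max (\<rho> y) (c - H y)"
      using continuous_attains_inf[OF KU False] by blast
    have "0 < max (\<rho> z) (c - H z)"
      using z(1) nonneg[of z] sub[of z] by (force simp: max_def)
    then show ?thesis using that z(2) by blast
  qed
  obtain B where B: "\<And>z. z \<in> K \<Longrightarrow> H z \<le> B"
    using continuous_attains_sup[OF K _ H] False by blast
  \<comment> \<open>The threshold is such that a penalty of at least \<open>m\<close> pushes even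
    the upper bound \<open>B\<close> of \<open>H\<close> down to \<open>c - m\<close>.\<close>
  have "\<forall>z\<in>K. c - m / 2 \<le> H z - \<kappa> * \<rho> z \<longrightarrow> z \<in> U" if \<kappa>: "max 0 ((B - c + m) / m) \<le> \<kappa>" for \<kappa>
  proof (intro ballI impI, rule ccontr)
    fix z assume z: "z \<in> K" "c - m / 2 \<le> H z - \<kappa> * \<rho> z" "z \<notin> U"
    then consider "m \<le> \<rho> z" | "H z \<le> c - m" using m(2)[of z] by force
    then show False
    proof cases
      case 1
      then have "\<kappa> * m \<le> \<kappa> * \<rho> z" using \<kappa> by (intro mult_left_mono) auto
      moreover have "B - c + m \<le> \<kappa> * m" using \<kappa> m(1) by (simp add: pos_divide_le_eq)
      ultimately show False using z B[OF z(1)] m(1) by linarith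
    next
      case 2
      moreover have "0 \<le> \<kappa> * \<rho> z" using \<kappa> nonneg[OF z(1)] by simp
      ultimately show False using z m(1) by linarith
    qed
  qed
  then have "\<forall>\<^sub>F \<kappa> in at_top. \<forall>z\<in>K. c - m / 2 \<le> H z - \<kappa> * \<rho> z \<longrightarrow> z \<in> U"
    by (rule eventually_at_top_linorderI)
  then show ?thesis using m(1) by (intro exI[of _ "m / 2"]) simp
qed

lemma triple_energy_penalty:
  assumes U: "open U"
    and sub: "\<And>P Q R. P \<in> simplex3 \<Longrightarrow> Q \<in> simplex3 \<Longrightarrow> R \<in> simplex3 \<Longrightarrow> permanent3 P Q R = 0 \<Longrightarrow>
      c \<le> entropy3 \<beta> P + entropy3 \<beta> Q + entropy3 \<beta> R \<Longrightarrow> (P, Q, R) \<in> U"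
  shows "\<exists>\<delta>>0. \<forall>\<^sub>F \<kappa> in at_top. \<forall>P\<in>simplex3. \<forall>Q\<in>simplex3. \<forall>R\<in>simplex3.
    c - \<delta> \<le> triple_energy \<beta> \<kappa> P Q R \<longrightarrow> (P, Q, R) \<in> U"
proof -
  let ?K = "simplex3 \<times> simplex3 \<times> simplex3"
  let ?H = "\<lambda>(P, Q, R). entropy3 \<beta> P + entropy3 \<beta> Q + entropy3 \<beta> R"
  have 1: "continuous_on ?K ?H"
    unfolding split_beta
    by (intro continuous_intros continuous_on_compose2[OF entropy3_continuous]) auto
  have 2: "continuous_on ?K (\<lambda>(P, Q, R). permanent3 P Q R)"
    unfolding split_beta permanent3_def by (intro continuous_intros)
  have "\<exists>\<delta>>0. \<forall>\<^sub>F \<kappa> in at_top. \<forall>z\<in>?K. c - \<delta> \<le> ?H z - \<kappa> * (\<lambda>(P, Q, R). permanent3 P Q R) z \<longrightarrow> z \<in> U"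
    by (rule compact_penalty[OF _ 1 2 _ U])
       (auto intro!: compact_Times compact_simplex3 permanent3_nonneg sub)
  then show ?thesis by (auto simp: triple_energy_def)
qed

lemma triple_energy_upper:
  assumes "\<eta> > 0"
  shows "\<forall>\<^sub>F \<kappa> in at_top. \<forall>P\<in>simplex3. \<forall>Q\<in>simplex3. \<forall>R\<in>simplex3.
    triple_energy \<beta> \<kappa> P Q R \<le> 3 * ln (max_weight \<beta>) + \<eta>"
proof -
  \<comment> \<open>The penalty principle with the empty open set: no rainbow-free triple reaches
    the raised level, hence for large \<open>\<kappa>\<close> no triple does.\<close>
  have "\<exists>\<delta>>0. \<forall>\<^sub>F \<kappa> in at_top. \<forall>P\<in>simplex3. \<forall>Q\<in>simplex3. \<forall>R\<in>simplex3.
    3 * ln (max_weight \<beta>) + \<eta> - \<delta> \<le> triple_energy \<beta> \<kappa> P Q R \<longrightarrow> (P, Q, R) \<in> {}"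
  proof (rule triple_energy_penalty)
    fix P Q R :: "real ^ 3"
    assume "P \<in> simplex3" "Q \<in> simplex3" "R \<in> simplex3" "permanent3 P Q R = 0"
      "3 * ln (max_weight \<beta>) + \<eta> \<le> entropy3 \<beta> P + entropy3 \<beta> Q + entropy3 \<beta> R"
    then show "(P, Q, R) \<in> {}" using rainbow_free_triple(1)[of P Q R \<beta>] assms by linarith
  qed simp
  then obtain \<delta> where "\<delta> > 0" and ev: "\<forall>\<^sub>F \<kappa> in at_top. \<forall>P\<in>simplex3. \<forall>Q\<in>simplex3. \<forall>R\<in>simplex3.
    triple_energy \<beta> \<kappa> P Q R < 3 * ln (max_weight \<beta>) + \<eta> - \<delta>"
    by (auto simp: not_le)
  show ?thesis using ev by eventually_elim (use \<open>\<delta> > 0\<close> in fastforce)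
qed

lemma triple_energy_stability:
  assumes "\<epsilon> > 0"
  shows "\<exists>\<delta>>0. \<forall>\<^sub>F \<kappa> in at_top. \<forall>P\<in>simplex3. \<forall>Q\<in>simplex3. \<forall>R\<in>simplex3.
    3 * ln (max_weight \<beta>) - \<delta> \<le> triple_energy \<beta> \<kappa> P Q R \<longrightarrow>
    (\<exists>p\<in>optimal_pairs \<beta>. P \<in> ball (two_color_vec \<beta> p) \<epsilon> \<and> Q \<in> ball (two_color_vec \<beta> p) \<epsilon> \<and>
      R \<in> ball (two_color_vec \<beta> p) \<epsilon>)"
proof -
  let ?B = "\<lambda>p. ball (two_color_vec \<beta> p) \<epsilon>"
  let ?U = "\<Union>p\<in>optimal_pairs \<beta>. ?B p \<times> ?B p \<times> ?B p"
  have "\<exists>\<delta>>0. \<forall>\<^sub>F \<kappa> in at_top. \<forall>P\<in>simplex3. \<forall>Q\<in>simplex3. \<forall>R\<in>simplex3.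
    3 * ln (max_weight \<beta>) - \<delta> \<le> triple_energy \<beta> \<kappa> P Q R \<longrightarrow> (P, Q, R) \<in> ?U"
  proof (rule triple_energy_penalty)
    show "open ?U" by (intro open_UN ballI open_Times open_ball)
    fix P Q R :: "real ^ 3"
    assume "P \<in> simplex3" "Q \<in> simplex3" "R \<in> simplex3" "permanent3 P Q R = 0"
      "3 * ln (max_weight \<beta>) \<le> entropy3 \<beta> P + entropy3 \<beta> Q + entropy3 \<beta> R"
      from rainbow_free_triple(2)[OF this] show "(P, Q, R) \<in> ?U"
      using centre_in_ball[of _ \<epsilon>] assms by blast
  qed
  then show ?thesis by simp
qed

section \<open>Diagonal maximizers\<close>

lemma triple_energy_commute:
  "triple_energy \<beta> \<kappa> Q P R = triple_energy \<beta> \<kappa> P Q R" "triple_energy \<beta> \<kappa> P R Q = triple_energy \<beta> \<kappa> P Q R"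
  by (simp_all add: triple_energy_def permanent3_commute)

text \<open>The permanent is linear in its first argument; its value at the unit vector
  \<open>axis i 1\<close> is the coefficient of \<open>P $ i\<close> in the expansion along the
  first row.\<close>

definition cofactor3 :: "real ^ 3 \<Rightarrow> real ^ 3 \<Rightarrow> real ^ 3" where
  "cofactor3 Q R = (\<chi> i. permanent3 (axis i 1) Q R)"

lemma cofactor3_color:
  assumes d: "distinct [a, b, c]"
  shows "cofactor3 Q R $ c = Q $ a * R $ b + Q $ b * R $ a"
  using d unfolding cofactor3_def permanent3_color[OF d] by (auto simp: axis_def)

lemma permanent3_eq_sum: "permanent3 P Q R = (\<Sum>i\<in>UNIV. P $ i * cofactor3 Q R $ i)"
  by (simp add: sum_3 cofactor3_def permanent3_def axis_def)

text \<open>With \<open>Q\<close> and \<open>R\<close> fixed, the energy is a Gibbs functional of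
  \<open>P\<close> in the field \<open>2 * \<beta>\<close> minus \<open>\<kappa>\<close> times the
  cofactors, so an optimal \<open>P\<close> is the Gibbs distribution. Taking the ratio of two
  components cancels the normalization and shows that a gap between cofactors suppresses a color
  exponentially in \<open>\<kappa>\<close>.\<close>

lemma triple_energy_maximizer_gibbs:
  assumes P: "P \<in> simplex3"
    and max: "\<And>P'. P' \<in> simplex3 \<Longrightarrow> triple_energy \<beta> \<kappa> P' Q R \<le> triple_energy \<beta> \<kappa> P Q R"
  shows "P $ c = P $ a * exp (2 * (\<beta> $ c - \<beta> $ a) - \<kappa> * (cofactor3 Q R $ c - cofactor3 Q R $ a))"
proof -
  define s where "s i = 2 * \<beta> $ i - \<kappa> * cofactor3 Q R $ i" for i
  define Z where "Z = (\<Sum>i\<in>UNIV. exp (s i))"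
  have Z: "Z > 0" unfolding Z_def by (intro sum_pos) auto
  define P' :: "real ^ 3" where "P' = (\<chi> i. exp (s i) / Z)"
  have eq: "triple_energy \<beta> \<kappa> X Q R = (\<Sum>i\<in>UNIV. s i * X $ i - X $ i * ln (X $ i)) + entropy3 \<beta> Q + entropy3 \<beta> R"
    for X
    by (simp add: triple_energy_def permanent3_eq_sum entropy3_def s_def sum_subtractf sum.distrib sum_distrib_left algebra_simps)
  have sP': "(\<Sum>i\<in>UNIV. P' $ i) = 1" using Z by (simp add: P'_def Z_def flip: sum_divide_distrib)
  have P': "P' \<in> simplex3" using Z sP' by (simp add: simplex3_altdef P'_def)
  have "s i * P' $ i - P' $ i * ln (P' $ i) = P' $ i * ln Z" for i
    using Z by (simp add: P'_def ln_div algebra_simps diff_divide_distrib)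
  then have "(\<Sum>i\<in>UNIV. s i * P' $ i - P' $ i * ln (P' $ i)) = ln Z"
    using sP' by (simp flip: sum_distrib_right)
  then have "ln Z \<le> (\<Sum>i\<in>UNIV. s i * P $ i - P $ i * ln (P $ i))"
    using max[OF P'] unfolding eq by simp
  then have "(\<Sum>i\<in>UNIV. s i * P $ i - P $ i * ln (P $ i)) = ln Z"
    using gibbs_inequality(1)[of UNIV "\<lambda>i. P $ i" s] simplex3D[OF P] by (simp add: Z_def)
  then have "P $ i = exp (s i) / Z" for i
    using gibbs_inequality(2)[of UNIV "\<lambda>i. P $ i" s i] simplex3D[OF P] by (simp add: Z_def)
  then have "P $ c = P $ a * exp (s c - s a)"
    by (simp add: exp_diff)
  also have "s c - s a = 2 * (\<beta> $ c - \<beta> $ a) - \<kappa> * (cofactor3 Q R $ c - cofactor3 Q R $ a)"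
    by (simp add: s_def algebra_simps)
  finally show ?thesis .
qed

text \<open>The left side is the entropy gain, the right side the change of penalty, in terms of the
  differences \<open>u, v, w\<close>. The \<open>u * v\<close> term has the small coefficient
  \<open>\<kappa> * r\<close>. In the terms with \<open>w\<close>, the inequality of arithmetic and
  geometric means turns \<open>\<kappa>\<close> into \<open>\<kappa>\<^sup>2 * w\<^sup>2\<close>,
  which is at most \<open>w\<^sup>2 / (16 * \<mu>)\<close>. The constants \<open>1 / 4\<close> and
  \<open>1 / 16\<close> make the right side at most half of the left.\<close>

lemma quadratic_form_bound:
  fixes u v w r x y \<kappa> \<mu> :: real
  assumes "0 < \<mu>" "0 \<le> \<kappa>" "\<kappa> * \<mu> \<le> 1 / 4" "\<kappa>\<^sup>2 * \<mu> \<le> 1 / 16"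
    and "0 \<le> r" "r \<le> \<mu>" "0 \<le> x" "x \<le> 1" "0 \<le> y" "y \<le> 1"
    and le: "(u\<^sup>2 + v\<^sup>2) / 4 + w\<^sup>2 / (4 * \<mu>) \<le> \<kappa> / 2 * (u * v * r + u * w * y + v * w * x)"
  shows "u = 0 \<and> v = 0 \<and> w = 0"
proof -
  have 1: "\<kappa> / 2 * (u * v * r) \<le> (u\<^sup>2 + v\<^sup>2) / 16"
  proof -
    have "u * v \<le> (u\<^sup>2 + v\<^sup>2) / 2"
      using zero_le_power2[of "u - v"] by (simp add: power2_diff)
    then have "(\<kappa> * r / 2) * (u * v) \<le> (\<kappa> * r / 2) * ((u\<^sup>2 + v\<^sup>2) / 2)"
      using assms by (intro mult_left_mono) auto
    also have "\<dots> \<le> (1 / 4 / 2) * ((u\<^sup>2 + v\<^sup>2) / 2)"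
      using assms mult_left_mono[OF \<open>r \<le> \<mu>\<close> \<open>0 \<le> \<kappa>\<close>] by (intro mult_right_mono) auto
    finally show ?thesis by (simp add: mult_ac)
  qed
  have 2: "\<kappa> / 2 * (u * w * y) \<le> u\<^sup>2 / 16 + w\<^sup>2 / (16 * \<mu>)" if "0 \<le> y" "y \<le> 1" for u y :: real
  proof -
    have "\<kappa> / 2 * (u * w * y) = 2 * (u / 4) * (\<kappa> * w * y)" by simp
    also have "\<dots> \<le> (u / 4)\<^sup>2 + (\<kappa> * w * y)\<^sup>2"
      using zero_le_power2[of "u / 4 - \<kappa> * w * y"] by (simp add: power2_diff)
    also have "(\<kappa> * w * y)\<^sup>2 \<le> (\<kappa> * w)\<^sup>2 * 1"
      using that by (subst power_mult_distrib) (intro mult_left_mono, auto simp: power_le_one)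
    also have "(\<kappa> * w)\<^sup>2 * 1 = \<kappa>\<^sup>2 * \<mu> * (w\<^sup>2 / \<mu>)" using assms(1) by (simp add: power_mult_distrib)
    also have "\<dots> \<le> 1 / 16 * (w\<^sup>2 / \<mu>)" using assms by (intro mult_right_mono) auto
    finally show ?thesis by (simp add: power_divide)
  qed
  have "\<kappa> / 2 * (u * v * r + u * w * y + v * w * x) =
      \<kappa> / 2 * (u * v * r) + \<kappa> / 2 * (u * w * y) + \<kappa> / 2 * (v * w * x)"
    by (simp add: algebra_simps)
  also have "\<dots> \<le> (u\<^sup>2 + v\<^sup>2) / 16 + (u\<^sup>2 / 16 + w\<^sup>2 / (16 * \<mu>)) + (v\<^sup>2 / 16 + w\<^sup>2 / (16 * \<mu>))"
    using 1 2[of y u] 2[of x v] assms by linarith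
  finally have "(u\<^sup>2 + v\<^sup>2) / 8 + w\<^sup>2 / (8 * \<mu>) \<le> 0"
    using le by (simp add: field_simps)
  moreover have "0 \<le> w\<^sup>2 / (8 * \<mu>)" using assms(1) by simp
  moreover have "A \<le> 0 \<and> B \<le> 0" if "A / 8 + B \<le> 0" "0 \<le> A" "0 \<le> B" for A B :: real
    using that by auto
  ultimately have "u\<^sup>2 + v\<^sup>2 \<le> 0 \<and> w\<^sup>2 / (8 * \<mu>) \<le> 0"
    using sum_power2_ge_zero[of u v] by blast
  then show ?thesis using assms(1) by (simp add: sum_power2_le_zero_iff divide_le_0_iff)
qed

text \<open>At the midpoint the entropy gain is of order \<open>(P\<^sub>c - Q\<^sub>c)\<^sup>2 / \<mu>\<close> in the suppressed color \<open>c\<close>, which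
  beats the change of the penalty although the latter carries the large factor \<open>\<kappa>\<close>.\<close>

lemma triple_energy_maximizer_equal:
  assumes P: "P \<in> simplex3" and Q: "Q \<in> simplex3" and R: "R \<in> simplex3" and d: "distinct [a, b, c]"
    and \<mu>: "0 < \<mu>" "P $ c \<le> \<mu>" "Q $ c \<le> \<mu>" "R $ c \<le> \<mu>"
    and \<kappa>: "0 \<le> \<kappa>" "\<kappa> * \<mu> \<le> 1 / 4" "\<kappa>\<^sup>2 * \<mu> \<le> 1 / 16"
    and max: "\<And>X. X \<in> simplex3 \<Longrightarrow> triple_energy \<beta> \<kappa> X X R \<le> triple_energy \<beta> \<kappa> P Q R"
  shows "P = Q"
proof -
  define X where "X = (1 / 2) *\<^sub>R (P + Q)"
  have Xi: "X $ i = (P $ i + Q $ i) / 2" for i by (simp add: X_def)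
  have "X \<in> simplex3"
    using simplex3D[OF P] simplex3D[OF Q]
    by (auto simp: simplex3_altdef Xi sum.distrib simp flip: sum_divide_distrib)
  define g where "g i = P $ i * ln (P $ i) + Q $ i * ln (Q $ i) - 2 * ((P $ i + Q $ i) / 2 * ln ((P $ i + Q $ i) / 2))" for i
  define u v w where "u = P $ a - Q $ a" and "v = P $ b - Q $ b" and "w = P $ c - Q $ c"
  have ent: "2 * entropy3 \<beta> X - entropy3 \<beta> P - entropy3 \<beta> Q = g a + g b + g c"
    by (simp add: entropy3_def sum_color[OF d] Xi g_def field_simps)
  \<comment> \<open>Polarization: the permanent is symmetric and bilinear in its first two
    arguments, so moving both to the midpoint changes it by a quarter of its value at
    \<open>(P - Q, P - Q, R)\<close>.\<close>
  have perm: "permanent3 X X R - permanent3 P Q R = (u * v * R $ c + u * w * R $ b + v * w * R $ a) / 2"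
    unfolding permanent3_color[OF d] Xi u_def v_def w_def by (simp add: field_simps)
  have "triple_energy \<beta> \<kappa> X X R \<le> triple_energy \<beta> \<kappa> P Q R" by (rule max) fact
  then have "g a + g b + g c \<le> \<kappa> * (permanent3 X X R - permanent3 P Q R)"
    unfolding ent[symmetric] by (simp add: triple_energy_def right_diff_distrib)
  \<comment> \<open>For the two surviving colors only the trivial bound 1 is available; the gain
    with factor \<open>1 / \<mu>\<close> comes from \<open>c\<close>.\<close>
  moreover have "u\<^sup>2 / 4 \<le> g a" "v\<^sup>2 / 4 \<le> g b" "w\<^sup>2 / (4 * \<mu>) \<le> g c"
    using midpoint_entropy_gain[of "P $ a" "Q $ a" 1] midpoint_entropy_gain[of "P $ b" "Q $ b" 1]
      midpoint_entropy_gain[of "P $ c" "Q $ c" \<mu>] simplex3D[OF P] simplex3D[OF Q] \<mu>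
    by (auto simp: u_def v_def w_def g_def)
  ultimately have "(u\<^sup>2 + v\<^sup>2) / 4 + w\<^sup>2 / (4 * \<mu>) \<le> \<kappa> / 2 * (u * v * R $ c + u * w * R $ b + v * w * R $ a)"
    unfolding perm by argo
  from quadratic_form_bound[OF \<mu>(1) \<kappa> _ \<mu>(4) _ _ _ _ this]
  have "u = 0 \<and> v = 0 \<and> w = 0" using simplex3D[OF R] by simp
  moreover have "i = a \<or> i = b \<or> i = c" for i
    using exhaust_3[of i] exhaust_3[of a] exhaust_3[of b] exhaust_3[of c] d by auto
  ultimately have "P $ i = Q $ i" for i
    unfolding u_def v_def w_def by (metis eq_iff_diff_eq_0)
  then show ?thesis by (simp add: vec_eq_iff)
qed

text \<open>The factor 2 leaves room for an error: a vector within \<open>m\<close> of an optimal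
  one still has both relevant components at least \<open>m\<close>.\<close>

lemma two_color_vec_lower:
  obtains m :: real where "0 < m"
    "\<And>a b. (a, b) \<in> color_pairs \<Longrightarrow> 2 * m \<le> two_color_vec \<beta> (a, b) $ a \<and> 2 * m \<le> two_color_vec \<beta> (a, b) $ b"
proof -
  define A where "A = (\<lambda>(a, b). two_color_vec \<beta> (a, b) $ a) ` color_pairs \<union> (\<lambda>(a, b). two_color_vec \<beta> (a, b) $ b) ` color_pairs"
  have A: "finite A" "A \<noteq> {}" by (auto simp: A_def)
  have "\<forall>x\<in>A. 0 < x"
    by (auto simp: A_def two_color_vec_nth intro!: divide_pos_pos add_pos_pos)
  then have "0 < Min A" using A by simp
  moreover have "2 * (Min A / 2) \<le> two_color_vec \<beta> (a, b) $ a \<and> 2 * (Min A / 2) \<le> two_color_vec \<beta> (a, b) $ b"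
    if "(a, b) \<in> color_pairs" for a b
  proof -
    have "two_color_vec \<beta> (a, b) $ a \<in> A"
      unfolding A_def using that by (intro UnI1 image_eqI[of _ _ "(a, b)"]) simp_all
    moreover have "two_color_vec \<beta> (a, b) $ b \<in> A"
      unfolding A_def using that by (intro UnI2 image_eqI[of _ _ "(a, b)"]) simp_all
    ultimately show ?thesis using A by simp
  qed
  ultimately show ?thesis using that[of "Min A / 2"] by simp
qed

lemma component_diff_less_of_ball:
  fixes x y :: "real ^ 3"
  assumes "x \<in> ball y e"
  shows "\<bar>x $ i - y $ i\<bar> < e"
  using assms dist_vec_nth_le[of x i y] by (simp add: dist_real_def dist_commute)

lemma triple_energy_attains_max:
  obtains P Q R where "P \<in> simplex3" "Q \<in> simplex3" "R \<in> simplex3"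
    "\<And>P' Q' R'. P' \<in> simplex3 \<Longrightarrow> Q' \<in> simplex3 \<Longrightarrow> R' \<in> simplex3 \<Longrightarrow>
      triple_energy \<beta> \<kappa> P' Q' R' \<le> triple_energy \<beta> \<kappa> P Q R"
proof -
  let ?K = "simplex3 \<times> simplex3 \<times> simplex3"
  let ?f = "\<lambda>(P, Q, R). triple_energy \<beta> \<kappa> P Q R"
  have cont: "continuous_on ?K ?f"
    unfolding split_beta triple_energy_def permanent3_def
    by (intro continuous_intros continuous_on_compose2[OF entropy3_continuous]) auto
  have comp: "compact ?K" by (intro compact_Times compact_simplex3)
  obtain p where "p \<in> color_pairs" using finite_color_pairs(2) by blast
  then have ne: "?K \<noteq> {}" using two_color_vec_simplex3[of p] by blast
  obtain z where z: "z \<in> ?K" "\<forall>y\<in>?K. ?f y \<le> ?f z"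
    using continuous_attains_sup[OF comp ne cont] by blast
  obtain P Q R where "z = (P, Q, R)" using prod_cases3 by blast
  with z show ?thesis using that[of P Q R] by simp
qed

lemma triple_energy_max_diagonal:
  "\<forall>\<^sub>F \<kappa> in at_top. \<exists>X\<in>simplex3. \<forall>P\<in>simplex3. \<forall>Q\<in>simplex3. \<forall>R\<in>simplex3.
    triple_energy \<beta> \<kappa> P Q R \<le> triple_energy \<beta> \<kappa> X X X"
proof -
  obtain m where m: "0 < m" and mle: "\<And>a b. (a, b) \<in> color_pairs \<Longrightarrow>
      2 * m \<le> two_color_vec \<beta> (a, b) $ a \<and> 2 * m \<le> two_color_vec \<beta> (a, b) $ b"
    using two_color_vec_lower[of \<beta>] by metis
  \<comment> \<open>\<open>\<epsilon> \<le> m\<close> keeps the two main components at least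
    \<open>m\<close>; \<open>2 * \<epsilon> \<le> m\<^sup>2\<close> makes the cofactor of the
    suppressed color exceed that of a main color by at least
    \<open>2 * m\<^sup>2 - 2 * \<epsilon> \<ge> m\<^sup>2\<close>.\<close>
  define \<epsilon> where "\<epsilon> = min m (m\<^sup>2 / 2)"
  have \<epsilon>: "0 < \<epsilon>" "\<epsilon> \<le> m" "2 * \<epsilon> \<le> m\<^sup>2" using m by (auto simp: \<epsilon>_def)
  \<comment> \<open>A maximum over all ordered pairs of colors, so that the bound
    \<open>\<mu>\<close> is fixed before the optimal pair near the maximizer is known.\<close>
  define K where "K = Max (range (\<lambda>(c, a). exp (2 * (\<beta> $ c - \<beta> $ a))))"
  have Kle: "exp (2 * (\<beta> $ c - \<beta> $ a)) \<le> K" for a c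
    unfolding K_def by (rule Max_ge) auto
  have K: "0 < K" using Kle[of 1 1] by simp
  define \<mu> where "\<mu> \<kappa> = K * exp (- (m\<^sup>2) * \<kappa>)" for \<kappa>
  have "((\<lambda>\<kappa>. \<kappa> * \<mu> \<kappa>) \<longlongrightarrow> 0) at_top"
    unfolding \<mu>_def using m K by real_asymp
  from order_tendstoD(2)[OF this, of "1 / 4"] have small1: "\<forall>\<^sub>F \<kappa> in at_top. \<kappa> * \<mu> \<kappa> < 1 / 4" by simp
  have "((\<lambda>\<kappa>. \<kappa>\<^sup>2 * \<mu> \<kappa>) \<longlongrightarrow> 0) at_top"
    unfolding \<mu>_def using m K by real_asymp
  from order_tendstoD(2)[OF this, of "1 / 16"] have small2: "\<forall>\<^sub>F \<kappa> in at_top. \<kappa>\<^sup>2 * \<mu> \<kappa> < 1 / 16" by simp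
  obtain \<delta> where "\<delta> > 0" and stab: "\<forall>\<^sub>F \<kappa> in at_top. \<forall>P\<in>simplex3. \<forall>Q\<in>simplex3. \<forall>R\<in>simplex3.
    3 * ln (max_weight \<beta>) - \<delta> \<le> triple_energy \<beta> \<kappa> P Q R \<longrightarrow>
    (\<exists>p\<in>optimal_pairs \<beta>. P \<in> ball (two_color_vec \<beta> p) \<epsilon> \<and> Q \<in> ball (two_color_vec \<beta> p) \<epsilon> \<and>
      R \<in> ball (two_color_vec \<beta> p) \<epsilon>)"
    using triple_energy_stability[OF \<epsilon>(1)] by blast
  show ?thesis
    using stab small1 small2 eventually_ge_at_top[of 0]
  proof eventually_elim
    case (elim \<kappa>)
    obtain P Q R where PQR: "P \<in> simplex3" "Q \<in> simplex3" "R \<in> simplex3"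
      and max: "\<And>P' Q' R'. P' \<in> simplex3 \<Longrightarrow> Q' \<in> simplex3 \<Longrightarrow> R' \<in> simplex3 \<Longrightarrow>
        triple_energy \<beta> \<kappa> P' Q' R' \<le> triple_energy \<beta> \<kappa> P Q R"
      using triple_energy_attains_max by blast
    obtain p0 where p0: "p0 \<in> optimal_pairs \<beta>" using optimal_pairs_nonempty by blast
    then have "two_color_vec \<beta> p0 \<in> simplex3" by (simp add: optimal_pairs_iff two_color_vec_simplex3)
    then have "3 * ln (max_weight \<beta>) \<le> triple_energy \<beta> \<kappa> P Q R"
      using max triple_energy_two_color_vec[OF p0, of \<kappa>] by metis
    then obtain p where p: "p \<in> optimal_pairs \<beta>" and near:
      "P \<in> ball (two_color_vec \<beta> p) \<epsilon>" "Q \<in> ball (two_color_vec \<beta> p) \<epsilon>" "R \<in> ball (two_color_vec \<beta> p) \<epsilon>"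
      using elim(1) PQR \<open>\<delta> > 0\<close> by fastforce
    obtain a b where pab: "p = (a, b)" by fastforce
    then have ab: "(a, b) \<in> color_pairs" using p by (simp add: optimal_pairs_iff)
    then obtain c where d: "distinct [a, b, c]" using color_pair_third by blast
    then have d': "distinct [b, c, a]" "c \<noteq> a" "c \<noteq> b" by auto
    have big: "m \<le> X $ a" "m \<le> X $ b" and tiny: "X $ c \<le> \<epsilon>"
      if "X \<in> ball (two_color_vec \<beta> p) \<epsilon>" for X
      using component_diff_less_of_ball[OF that, of a] component_diff_less_of_ball[OF that, of b]
        component_diff_less_of_ball[OF that, of c] mle[OF ab] \<epsilon> d'(2,3)
      by (auto simp: pab two_color_vec_nth[of _ _ _ c])
    have le_\<mu>: "X $ c \<le> \<mu> \<kappa>"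
      if X: "X \<in> simplex3" and Y: "Y \<in> simplex3" and Z: "Z \<in> simplex3"
        and nY: "Y \<in> ball (two_color_vec \<beta> p) \<epsilon>" and nZ: "Z \<in> ball (two_color_vec \<beta> p) \<epsilon>"
        and mx: "\<And>X'. X' \<in> simplex3 \<Longrightarrow> triple_energy \<beta> \<kappa> X' Y Z \<le> triple_energy \<beta> \<kappa> X Y Z"
      for X Y Z
    proof -
      \<comment> \<open>The cofactor of \<open>c\<close> multiplies main components only, whereas
        each product in the cofactor of \<open>a\<close> contains a small component of color
        \<open>c\<close>.\<close>
      have "m * m + m * m \<le> cofactor3 Y Z $ c"
        unfolding cofactor3_color[OF d] using big[OF nY] big[OF nZ] m by (intro add_mono mult_mono) auto
      moreover have "cofactor3 Y Z $ a \<le> 1 * \<epsilon> + \<epsilon> * 1"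
        unfolding cofactor3_color[OF d'(1)] using tiny[OF nY] tiny[OF nZ] simplex3D[OF Y] simplex3D[OF Z] \<epsilon>
        by (intro add_mono mult_mono) auto
      ultimately have "m\<^sup>2 \<le> cofactor3 Y Z $ c - cofactor3 Y Z $ a"
        using \<epsilon>(3) by (simp add: power2_eq_square)
      then have "\<kappa> * m\<^sup>2 \<le> \<kappa> * (cofactor3 Y Z $ c - cofactor3 Y Z $ a)"
        using elim by (intro mult_left_mono) auto
      then have "exp (2 * (\<beta> $ c - \<beta> $ a) - \<kappa> * (cofactor3 Y Z $ c - cofactor3 Y Z $ a)) \<le>
          exp (2 * (\<beta> $ c - \<beta> $ a)) * exp (- (m\<^sup>2) * \<kappa>)"
        unfolding exp_add[symmetric] by (simp add: mult.commute)
      also have "\<dots> \<le> \<mu> \<kappa>" unfolding \<mu>_def by (intro mult_right_mono Kle) auto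
      finally have "X $ a * exp (2 * (\<beta> $ c - \<beta> $ a) - \<kappa> * (cofactor3 Y Z $ c - cofactor3 Y Z $ a)) \<le> 1 * \<mu> \<kappa>"
        using simplex3D[OF X] by (intro mult_mono) auto
      then show ?thesis using triple_energy_maximizer_gibbs[OF X mx, of c a] by simp
    qed
    have comm: "triple_energy \<beta> \<kappa> Q P R = triple_energy \<beta> \<kappa> P Q R"
      "triple_energy \<beta> \<kappa> R P Q = triple_energy \<beta> \<kappa> P Q R" "triple_energy \<beta> \<kappa> Q R P = triple_energy \<beta> \<kappa> P Q R"
      using triple_energy_commute by metis+
    have \<mu>pos: "0 < \<mu> \<kappa>" using K by (simp add: \<mu>_def)
    have le: "P $ c \<le> \<mu> \<kappa>" "Q $ c \<le> \<mu> \<kappa>" "R $ c \<le> \<mu> \<kappa>"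
      using le_\<mu>[of P Q R] le_\<mu>[of Q P R] le_\<mu>[of R P Q] PQR near max unfolding comm by blast+
    have "P = Q"
      by (rule triple_energy_maximizer_equal[OF PQR d \<mu>pos le]) (use elim max PQR in auto)
    \<comment> \<open>The energy is symmetric, so the argument that gave \<open>P = Q\<close>
      applies again with the roles of the three distributions rotated.\<close>
    moreover have "triple_energy \<beta> \<kappa> X X P \<le> triple_energy \<beta> \<kappa> Q R P" if "X \<in> simplex3" for X
      unfolding comm using max PQR that by simp
    then have "Q = R"
      by (rule triple_energy_maximizer_equal[OF PQR(2,3,1) d \<mu>pos le(2,3,1), rotated 3]) (use elim in auto)
    ultimately show ?case using PQR max by blast
  qed
qed

section \<open>The functional as an integral over triangles\<close>

text \<open>A density on the whole line instead of a restricted space: its space is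
  \<open>UNIV\<close> and its measurable sets are the Borel sets, so products need no bookkeeping of
  subspaces.\<close>

definition unit_prob :: "real measure" where
  "unit_prob = density lborel (indicator {0..1})"

abbreviation unit_prob2 :: "(real \<times> real) measure" where
  "unit_prob2 \<equiv> unit_prob \<Otimes>\<^sub>M unit_prob"

abbreviation unit_prob3 :: "(real \<times> real \<times> real) measure" where
  "unit_prob3 \<equiv> unit_prob \<Otimes>\<^sub>M unit_prob2"

lemma sets_unit_prob [simp, measurable_cong]: "sets unit_prob = sets borel"
  by (simp add: unit_prob_def)

lemma space_unit_prob [simp]: "space unit_prob = UNIV"
  by (simp add: unit_prob_def)

lemma sets_unit_prob2: "sets unit_prob2 = sets borel"
  using sets_pair_measure_cong[OF sets_unit_prob sets_unit_prob] by (simp only: borel_prod)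

lemma emeasure_unit_prob:
  assumes "A \<in> sets borel"
  shows "emeasure unit_prob A = emeasure lborel ({0..1} \<inter> A)"
proof -
  have "emeasure unit_prob A = (\<integral>\<^sup>+x. indicator {0..1} x * indicator A x \<partial>lborel)"
    using assms unfolding unit_prob_def by (intro emeasure_density) auto
  also have "\<dots> = (\<integral>\<^sup>+x. indicator ({0..1} \<inter> A) x \<partial>lborel)"
    by (intro nn_integral_cong) (auto simp: indicator_def)
  also have "\<dots> = emeasure lborel ({0..1} \<inter> A)"
    using assms by (intro nn_integral_indicator) auto
  finally show ?thesis .
qed

interpretation unit_prob: prob_space unit_prob
  by standard (simp add: emeasure_unit_prob)

interpretation unit_prob2: pair_prob_space unit_prob unit_prob ..

interpretation unit_prob3: pair_prob_space unit_prob unit_prob2 ..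

lemma unit_prob2_eq: "unit_prob2 = density lborel (indicator ({0..1} \<times> {0..1}))"
proof -
  have "unit_prob2 = density (lborel \<Otimes>\<^sub>M lborel) (\<lambda>(x, y). indicator {0..1} x * indicator {0..1} y)"
    unfolding unit_prob_def
    by (rule pair_measure_density) (auto intro: sigma_finite_lborel unit_prob.sigma_finite_measure simp flip: unit_prob_def)
  also have "(\<lambda>(x, y). indicator {0..1} x * indicator {0..1} y :: ennreal) = indicator ({0..1::real} \<times> {0..1::real})"
    by (auto simp: fun_eq_iff indicator_def)
  finally show ?thesis by (simp add: lborel_prod)
qed

lemma unit_prob3_eq: "unit_prob3 = density lborel (indicator ({0..1} \<times> {0..1} \<times> {0..1}))"
proof -
  have "sigma_finite_measure (density (lborel :: (real \<times> real) measure) (indicator ({0..1} \<times> {0..1})))"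
    unfolding unit_prob2_eq[symmetric] by (rule unit_prob2.sigma_finite_measure)
  then have "density lborel (indicator {0..1::real}) \<Otimes>\<^sub>M density (lborel :: (real \<times> real) measure) (indicator ({0..1} \<times> {0..1}))
    = density (lborel \<Otimes>\<^sub>M lborel) (\<lambda>(x, y). indicator {0..1} x * indicator ({0..1} \<times> {0..1}) y)"
    by (intro pair_measure_density) (auto intro: sigma_finite_lborel intro!: borel_measurable_indicator borel_closed closed_Times)
  also have "(\<lambda>(x, y). indicator {0..1} x * indicator ({0..1} \<times> {0..1}) y :: ennreal) =
      indicator ({0..1::real} \<times> {0..1::real} \<times> {0..1::real})"
    by (auto simp: fun_eq_iff indicator_def)
  finally have "density lborel (indicator {0..1::real}) \<Otimes>\<^sub>M density (lborel :: (real \<times> real) measure) (indicator ({0..1} \<times> {0..1})) =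
      density lborel (indicator ({0..1::real} \<times> {0..1::real} \<times> {0..1::real}))"
    by (simp add: lborel_prod)
  then show ?thesis unfolding unit_prob2_eq[symmetric] unfolding unit_prob_def[symmetric] .
qed

lemma set_lebesgue_integral_eq_density:
  fixes f g :: "'a::euclidean_space \<Rightarrow> real"
  assumes "A \<in> sets borel" "g \<in> borel_measurable borel" "\<And>x. x \<in> A \<Longrightarrow> f x = g x"
  shows "set_lebesgue_integral lborel A f = (\<integral>x. g x \<partial>density lborel (indicator A))"
proof -
  have "(\<integral>x. g x \<partial>density lborel (\<lambda>x. ennreal (indicator A x))) = (\<integral>x. indicator A x *\<^sub>R g x \<partial>lborel)"
    using assms by (intro integral_density) auto
  also have "\<dots> = set_lebesgue_integral lborel A f"
    unfolding set_lebesgue_integral_def by (rule Bochner_Integration.integral_cong) (auto simp: indicator_def assms)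
  finally show ?thesis by (simp add: ennreal_indicator)
qed

lemma measure_preserving_swap23:
  "distr unit_prob3 unit_prob3 (\<lambda>(x, y, z). (x, z, y)) = unit_prob3"
proof -
  have sw: "distr unit_prob2 unit_prob2 (\<lambda>(y, z). (z, y)) = unit_prob2"
    using unit_prob2.distr_pair_swap by simp
  have id: "distr unit_prob unit_prob (\<lambda>x. x) = unit_prob" by (rule distr_id)
  have "unit_prob3 = distr unit_prob unit_prob (\<lambda>x. x) \<Otimes>\<^sub>M distr unit_prob2 unit_prob2 (\<lambda>(y, z). (z, y))"
    by (simp only: sw id)
  also have "\<dots> = distr unit_prob3 unit_prob3 (\<lambda>(x, p). (x, (\<lambda>(y, z). (z, y)) p))"
    by (rule pair_measure_distr) (auto simp: sw unit_prob2.sigma_finite_measure)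
  finally show ?thesis by (simp add: split_beta')
qed

text \<open>Unlike the exchange of the last two coordinates, this one does not act within a factor
  of the nested product, so it is reduced to iterated integrals and Tonelli's theorem.\<close>

lemma measure_preserving_swap12:
  "distr unit_prob3 unit_prob3 (\<lambda>(x, y, z). (y, x, z)) = unit_prob3" (is "distr _ _ ?s = _")
proof (rule measure_eqI)
  fix A assume "A \<in> sets (distr unit_prob3 unit_prob3 ?s)"
  then have A [measurable]: "A \<in> sets unit_prob3" by simp
  have iter: "emeasure unit_prob3 B = (\<integral>\<^sup>+x. \<integral>\<^sup>+y. \<integral>\<^sup>+z. indicator B (x, y, z) \<partial>unit_prob \<partial>unit_prob \<partial>unit_prob)"
    if [measurable]: "B \<in> sets unit_prob3" for B
  proof -
    have "emeasure unit_prob3 B = (\<integral>\<^sup>+w. indicator B w \<partial>unit_prob3)"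
      by (rule nn_integral_indicator[symmetric]) (rule that)
    also have "\<dots> = (\<integral>\<^sup>+x. \<integral>\<^sup>+p. indicator B (x, p) \<partial>unit_prob2 \<partial>unit_prob)"
      by (rule unit_prob2.nn_integral_fst[symmetric]) simp
    also have "\<dots> = (\<integral>\<^sup>+x. \<integral>\<^sup>+y. \<integral>\<^sup>+z. indicator B (x, y, z) \<partial>unit_prob \<partial>unit_prob \<partial>unit_prob)"
      by (intro nn_integral_cong unit_prob.nn_integral_fst[symmetric]) simp
    finally show ?thesis .
  qed
  have s [measurable]: "?s \<in> measurable unit_prob3 unit_prob3" by simp
  have "emeasure (distr unit_prob3 unit_prob3 ?s) A = emeasure unit_prob3 (?s -` A \<inter> space unit_prob3)"
    by (rule emeasure_distr[OF s A])
  also have "\<dots> = (\<integral>\<^sup>+x. \<integral>\<^sup>+y. \<integral>\<^sup>+z. indicator A (y, x, z) \<partial>unit_prob \<partial>unit_prob \<partial>unit_prob)"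
    unfolding iter[OF measurable_sets[OF s A]]
    by (intro nn_integral_cong) (auto simp: indicator_def space_pair_measure)
  also have "\<dots> = (\<integral>\<^sup>+y. \<integral>\<^sup>+x. \<integral>\<^sup>+z. indicator A (y, x, z) \<partial>unit_prob \<partial>unit_prob \<partial>unit_prob)"
    by (rule unit_prob2.Fubini'[symmetric]) simp
  also have "\<dots> = emeasure unit_prob3 A" by (rule iter[OF A, symmetric])
  finally show "emeasure (distr unit_prob3 unit_prob3 ?s) A = emeasure unit_prob3 A" .
qed simp

text \<open>Every edge of a uniformly random triangle is a uniformly random pair. One projection is
  computed directly, the others follow by composing with coordinate exchanges.\<close>

lemma measure_preserving_projections:
  "distr unit_prob3 unit_prob2 (\<lambda>(x, y, z). (y, z)) = unit_prob2"
  "distr unit_prob3 unit_prob2 (\<lambda>(x, y, z). (x, z)) = unit_prob2"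
  "distr unit_prob3 unit_prob2 (\<lambda>(x, y, z). (x, y)) = unit_prob2"
proof -
  have m: "(\<lambda>(x, y, z). (y, z)) \<in> measurable unit_prob3 unit_prob2" by measurable
  show 1: "distr unit_prob3 unit_prob2 (\<lambda>(x, y, z). (y, z)) = unit_prob2"
  proof (rule measure_eqI)
    fix A assume "A \<in> sets (distr unit_prob3 unit_prob2 (\<lambda>(x, y, z). (y, z)))"
    then have A: "A \<in> sets unit_prob2" by simp
    have "(\<lambda>(x, y, z). (y, z)) -` A \<inter> space unit_prob3 = (UNIV :: real set) \<times> A"
      by (auto simp: space_pair_measure)
    then have "emeasure (distr unit_prob3 unit_prob2 (\<lambda>(x, y, z). (y, z))) A = emeasure unit_prob3 (UNIV \<times> A)"
      using emeasure_distr[OF m A] by simp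
    also have "\<dots> = emeasure unit_prob UNIV * emeasure unit_prob2 A"
      using A by (intro unit_prob2.emeasure_pair_measure_Times) simp_all
    finally show "emeasure (distr unit_prob3 unit_prob2 (\<lambda>(x, y, z). (y, z))) A = emeasure unit_prob2 A"
      using unit_prob.emeasure_space_1 by simp
  qed simp
  have "unit_prob2 = distr (distr unit_prob3 unit_prob3 (\<lambda>(x, y, z). (y, x, z))) unit_prob2 (\<lambda>(x, y, z). (y, z))"
    unfolding measure_preserving_swap12 1 ..
  also have "\<dots> = distr unit_prob3 unit_prob2 (\<lambda>(x, y, z). (x, z))"
    by (subst distr_distr) (auto simp: comp_def split_beta')
  finally show 2: "distr unit_prob3 unit_prob2 (\<lambda>(x, y, z). (x, z)) = unit_prob2" ..
  have "unit_prob2 = distr (distr unit_prob3 unit_prob3 (\<lambda>(x, y, z). (x, z, y))) unit_prob2 (\<lambda>(x, y, z). (x, z))"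
    unfolding measure_preserving_swap23 2 ..
  also have "\<dots> = distr unit_prob3 unit_prob2 (\<lambda>(x, y, z). (x, y))"
    by (subst distr_distr) (auto simp: comp_def split_beta')
  finally show "distr unit_prob3 unit_prob2 (\<lambda>(x, y, z). (x, y)) = unit_prob2" ..
qed

text \<open>Graphons are only constrained on the unit square; extending them by a constant gives
  functions that are measurable, symmetric and simplex-valued on the whole plane.\<close>

definition total_graphon :: "kernel3 \<Rightarrow> bool" where
  "total_graphon V \<longleftrightarrow> (\<lambda>(x, y). V x y) \<in> borel_measurable borel \<and> (\<forall>x y. V x y \<in> simplex3 \<and> V x y = V y x)"

definition graphon_extension :: "kernel3 \<Rightarrow> kernel3" where
  "graphon_extension W x y = (if x \<in> {0..1} \<and> y \<in> {0..1} then W x y else axis 1 1)"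

lemma graphon_extension_eq: "x \<in> {0..1} \<Longrightarrow> y \<in> {0..1} \<Longrightarrow> graphon_extension W x y = W x y"
  by (simp add: graphon_extension_def)

lemma axis_simplex3: "axis i 1 \<in> simplex3"
  by (auto simp: simplex3_altdef axis_def)

lemma total_graphon_extension:
  assumes "W \<in> graphons"
  shows "total_graphon (graphon_extension W)"
proof -
  have "(\<lambda>(x, y). W x y) \<in> borel_measurable (restrict_space borel ({0..1} \<times> {0..1}))"
    using assms by (simp add: graphons_def)
  then have "(\<lambda>p. if p \<in> {0..1} \<times> {0..1} then (\<lambda>(x, y). W x y) p else axis 1 1) \<in> borel_measurable borel"
    by (subst (asm) measurable_restrict_space_iff[where c = "axis 1 1"])
       (auto intro!: borel_closed closed_Times)
  moreover have "(\<lambda>p. if p \<in> {0..1} \<times> {0..1} then (\<lambda>(x, y). W x y) p else axis 1 1) = (\<lambda>(x, y). graphon_extension W x y)"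
    by (auto simp: graphon_extension_def fun_eq_iff)
  ultimately show ?thesis
    using assms by (auto simp: total_graphon_def graphons_def graphon_extension_def axis_simplex3)
qed

lemma total_graphonD:
  assumes "total_graphon V"
  shows "V x y \<in> simplex3" "V x y = V y x"
  using assms by (auto simp: total_graphon_def)

lemma total_graphon_measurable:
  assumes V: "total_graphon V" and f: "f \<in> measurable M borel" and g: "g \<in> measurable M borel"
  shows "(\<lambda>w. V (f w) (g w)) \<in> borel_measurable M"
proof -
  have "(\<lambda>w. (f w, g w)) \<in> measurable M (borel \<Otimes>\<^sub>M borel)" using f g by simp
  then have "(\<lambda>w. (f w, g w)) \<in> borel_measurable M" unfolding borel_prod .
  moreover have "(\<lambda>(x, y). V x y) \<in> borel_measurable borel" using V by (simp add: total_graphon_def)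
  ultimately have "(\<lambda>w. (\<lambda>(x, y). V x y) (f w, g w)) \<in> borel_measurable M" by (rule measurable_compose)
  then show ?thesis by simp
qed

section \<open>The functionals as integrals of the extended graphon\<close>

lemma square_integral_eq:
  assumes W: "W \<in> graphons" and f: "f \<in> borel_measurable borel"
  shows "square_integral (\<lambda>x y. f (W x y)) = (\<integral>(x, y). f (graphon_extension W x y) \<partial>unit_prob2)"
proof -
  have m: "(\<lambda>(x, y). f (graphon_extension W x y)) \<in> borel_measurable borel"
    using measurable_compose[OF _ f, of "\<lambda>(x, y). graphon_extension W x y"] total_graphon_extension[OF W]
    by (simp add: total_graphon_def split_beta')
  show ?thesis
    unfolding square_integral_def unit_prob2_eq
    by (rule set_lebesgue_integral_eq_density[OF _ m]) (auto simp: graphon_extension_eq intro!: borel_closed closed_Times)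
qed

lemma rainbow_density_eq:
  assumes W: "W \<in> graphons" and V: "V = graphon_extension W"
  shows "rainbow_density W = (\<integral>(x, y, z). V x y $ 1 * V y z $ 2 * V z x $ 3 \<partial>unit_prob3)"
proof -
  have t: "total_graphon V" using total_graphon_extension[OF W] V by simp
  have m: "(\<lambda>(x, y, z). V x y $ 1 * V y z $ 2 * V z x $ 3) \<in> borel_measurable borel"
    unfolding split_beta' borel_prod[symmetric]
    by (intro borel_measurable_times measurable_compose[OF total_graphon_measurable[OF t] borel_measurable_nth]) measurable
  show ?thesis
    unfolding rainbow_density_def unit_prob3_eq
    by (rule set_lebesgue_integral_eq_density[OF _ m]) (auto simp: V graphon_extension_eq intro!: borel_closed closed_Times)
qed

lemma borel_measurable_entropy3 [measurable]: "entropy3 \<beta> \<in> borel_measurable borel"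
  unfolding entropy3_def by measurable

lemma entropy3_bounded: "\<exists>B. \<forall>P\<in>simplex3. \<bar>entropy3 \<beta> P\<bar> \<le> B"
proof -
  have "bounded (entropy3 \<beta> ` simplex3)"
    by (intro compact_imp_bounded compact_continuous_image entropy3_continuous compact_simplex3)
  then show ?thesis by (auto simp: bounded_iff)
qed

lemma total_graphon_triple_measurable:
  assumes "total_graphon V"
  shows "(\<lambda>(x, y, z). V x y) \<in> borel_measurable unit_prob3"
    "(\<lambda>(x, y, z). V y z) \<in> borel_measurable unit_prob3"
    "(\<lambda>(x, y, z). V z x) \<in> borel_measurable unit_prob3"
    "(\<lambda>(x, y). V x y) \<in> borel_measurable unit_prob2"
  unfolding split_beta' by (intro total_graphon_measurable[OF assms]; measurable)+

lemma integral_unit_prob3_marginals: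
  fixes f :: "real \<times> real \<Rightarrow> real"
  assumes "f \<in> borel_measurable unit_prob2"
  shows "(\<integral>(x, y, z). f (y, z) \<partial>unit_prob3) = (\<integral>p. f p \<partial>unit_prob2)"
    "(\<integral>(x, y, z). f (x, z) \<partial>unit_prob3) = (\<integral>p. f p \<partial>unit_prob2)"
    "(\<integral>(x, y, z). f (x, y) \<partial>unit_prob3) = (\<integral>p. f p \<partial>unit_prob2)"
proof -
  have "(\<lambda>(x, y, z). (y, z)) \<in> measurable unit_prob3 unit_prob2" by measurable
  from integral_distr[OF this assms] show "(\<integral>(x, y, z). f (y, z) \<partial>unit_prob3) = (\<integral>p. f p \<partial>unit_prob2)"
    unfolding measure_preserving_projections by (simp add: split_beta')
  have "(\<lambda>(x, y, z). (x, z)) \<in> measurable unit_prob3 unit_prob2" by measurable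
  from integral_distr[OF this assms] show "(\<integral>(x, y, z). f (x, z) \<partial>unit_prob3) = (\<integral>p. f p \<partial>unit_prob2)"
    unfolding measure_preserving_projections by (simp add: split_beta')
  have "(\<lambda>(x, y, z). (x, y)) \<in> measurable unit_prob3 unit_prob2" by measurable
  from integral_distr[OF this assms] show "(\<integral>(x, y, z). f (x, y) \<partial>unit_prob3) = (\<integral>p. f p \<partial>unit_prob2)"
    unfolding measure_preserving_projections by (simp add: split_beta')
qed

definition color_triangle_density :: "kernel3 \<Rightarrow> 3 \<Rightarrow> 3 \<Rightarrow> 3 \<Rightarrow> real" where
  "color_triangle_density V a b c = (\<integral>(x, y, z). V x y $ a * V y z $ b * V z x $ c \<partial>unit_prob3)"

lemma triangle_measurable:
  assumes V: "total_graphon V"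
  shows "(\<lambda>(x, y, z). V x y $ a * V y z $ b * V z x $ c) \<in> borel_measurable unit_prob3"
proof -
  have "(\<lambda>w. (\<lambda>(x, y, z). V x y) w $ a * (\<lambda>(x, y, z). V y z) w $ b * (\<lambda>(x, y, z). V z x) w $ c)
    \<in> borel_measurable unit_prob3"
    by (intro borel_measurable_times measurable_compose[OF _ borel_measurable_nth] total_graphon_triple_measurable[OF V])
  then show ?thesis by (simp add: split_beta')
qed

text \<open>Exchanging two vertices of a triangle fixes the edge between them and interchanges the
  other two; by symmetry of \<open>V\<close> this transposes two color arguments. The two
  transpositions shown generate all permutations of the colors.\<close>

lemma color_triangle_density_commute:
  assumes V: "total_graphon V"
  shows "color_triangle_density V a c b = color_triangle_density V a b c"
    "color_triangle_density V c b a = color_triangle_density V a b c"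
proof -
  have "(\<lambda>(x, y, z). (y, x, z)) \<in> measurable unit_prob3 unit_prob3" by measurable
  from integral_distr[OF this triangle_measurable[OF V, of a b c]]
  show "color_triangle_density V a c b = color_triangle_density V a b c"
    unfolding measure_preserving_swap12 color_triangle_density_def
    by (simp add: split_beta' total_graphonD(2)[OF V, of "fst (snd _)" "fst _"]
        total_graphonD(2)[OF V, of "snd (snd _)"] mult_ac)
  have "(\<lambda>(x, y, z). (x, z, y)) \<in> measurable unit_prob3 unit_prob3" by measurable
  from integral_distr[OF this triangle_measurable[OF V, of a b c]]
  show "color_triangle_density V c b a = color_triangle_density V a b c"
    unfolding measure_preserving_swap23 color_triangle_density_def
    by (simp add: split_beta' total_graphonD(2)[OF V, of "fst (snd _)" "fst _"]
        total_graphonD(2)[OF V, of "snd (snd _)"] mult_ac)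
qed

lemma integrable_triangle:
  assumes V: "total_graphon V"
  shows "integrable unit_prob3 (\<lambda>(x, y, z). V x y $ a * V y z $ b * V z x $ c)"
proof (rule unit_prob3.integrable_const_bound[where B = 1])
  show "AE w in unit_prob3. norm ((\<lambda>(x, y, z). V x y $ a * V y z $ b * V z x $ c) w) \<le> 1"
    using total_graphonD(1)[OF V, THEN simplex3D(1)] total_graphonD(1)[OF V, THEN simplex3D(2)]
    by (auto simp: abs_mult intro!: AE_I2 mult_le_one)
qed (rule triangle_measurable[OF V])

lemma integral_permanent3:
  assumes V: "total_graphon V"
  shows "integrable unit_prob3 (\<lambda>(x, y, z). permanent3 (V x y) (V y z) (V z x))" (is ?i)
    and "(\<integral>(x, y, z). permanent3 (V x y) (V y z) (V z x) \<partial>unit_prob3) = 6 * color_triangle_density V 1 2 3" (is ?e)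
proof -
  have eq: "(\<lambda>(x, y, z). permanent3 (V x y) (V y z) (V z x)) = (\<lambda>w.
      (\<lambda>(x, y, z). V x y $ 1 * V y z $ 2 * V z x $ 3) w + (\<lambda>(x, y, z). V x y $ 1 * V y z $ 3 * V z x $ 2) w +
      (\<lambda>(x, y, z). V x y $ 2 * V y z $ 1 * V z x $ 3) w + (\<lambda>(x, y, z). V x y $ 2 * V y z $ 3 * V z x $ 1) w +
      (\<lambda>(x, y, z). V x y $ 3 * V y z $ 1 * V z x $ 2) w + (\<lambda>(x, y, z). V x y $ 3 * V y z $ 2 * V z x $ 1) w)"
    by (auto simp: fun_eq_iff permanent3_def algebra_simps)
  note i = integrable_triangle[OF V]
  show ?i unfolding eq by (intro Bochner_Integration.integrable_add i)
  have "(\<integral>(x, y, z). permanent3 (V x y) (V y z) (V z x) \<partial>unit_prob3) =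
      color_triangle_density V 1 2 3 + color_triangle_density V 1 3 2 + color_triangle_density V 2 1 3 +
      color_triangle_density V 2 3 1 + color_triangle_density V 3 1 2 + color_triangle_density V 3 2 1"
    unfolding eq color_triangle_density_def by (simp only: Bochner_Integration.integral_add Bochner_Integration.integrable_add i)
  also have "\<dots> = 6 * color_triangle_density V 1 2 3"
    using color_triangle_density_commute[OF V, of 1 2 3] color_triangle_density_commute[OF V, of 1 3 2]
      color_triangle_density_commute[OF V, of 2 1 3] color_triangle_density_commute[OF V, of 2 3 1]
      color_triangle_density_commute[OF V, of 3 1 2] color_triangle_density_commute[OF V, of 3 2 1] by linarith
  finally show ?e .
qed

lemma integrable_unit_prob2_bounded:
  fixes f :: "real ^ 3 \<Rightarrow> real"
  assumes V: "total_graphon V" and f: "f \<in> borel_measurable borel" and B: "\<And>P. P \<in> simplex3 \<Longrightarrow> \<bar>f P\<bar> \<le> B"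
  shows "integrable unit_prob2 (\<lambda>(x, y). f (V x y))"
proof (rule unit_prob2.integrable_const_bound[where B = B])
  show "(\<lambda>(x, y). f (V x y)) \<in> borel_measurable unit_prob2"
    using measurable_compose[OF total_graphon_triple_measurable(4)[OF V] f] by (simp add: split_beta')
qed (use B total_graphonD(1)[OF V] in \<open>auto intro!: AE_I2\<close>)

lemma entropy3_integral:
  assumes W: "W \<in> graphons" and V: "V = graphon_extension W"
  shows "integrable unit_prob2 (\<lambda>(x, y). entropy3 \<beta> (V x y))"
    and "(\<integral>(x, y). entropy3 \<beta> (V x y) \<partial>unit_prob2) =
      2 * (\<Sum>a\<in>UNIV. \<beta> $ a * square_integral (\<lambda>x y. W x y $ a)) - entropy_fun W"
proof -
  have t: "total_graphon V" using total_graphon_extension[OF W] V by simp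
  obtain B where "\<forall>P\<in>simplex3. \<bar>entropy3 \<beta> P\<bar> \<le> B" using entropy3_bounded by blast
  then show "integrable unit_prob2 (\<lambda>(x, y). entropy3 \<beta> (V x y))"
    by (intro integrable_unit_prob2_bounded[OF t, where B = B]) (auto intro: borel_measurable_entropy3)
  have i1: "integrable unit_prob2 (\<lambda>(x, y). V x y $ a)" for a
    by (rule integrable_unit_prob2_bounded[OF t, where B = 1]) (auto simp: simplex3D)
  have i2: "integrable unit_prob2 (\<lambda>(x, y). V x y $ a * ln (V x y $ a))" for a
  proof (rule integrable_unit_prob2_bounded[OF t, where B = 2])
    fix P :: "real ^ 3" assume "P \<in> simplex3"
    then have "0 \<le> P $ a" "P $ a \<le> 1" by (auto simp: simplex3D)
    then have "\<bar>P $ a * ln (P $ a)\<bar> \<le> 2 * sqrt (P $ a)" "sqrt (P $ a) \<le> 1"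
      using abs_mult_ln_le_sqrt by auto
    then show "\<bar>P $ a * ln (P $ a)\<bar> \<le> 2" by linarith
  qed measurable
  have s1: "square_integral (\<lambda>x y. W x y $ a) = (\<integral>(x, y). V x y $ a \<partial>unit_prob2)" for a
    unfolding V by (rule square_integral_eq[OF W]) measurable
  have s2: "square_integral (\<lambda>x y. W x y $ a * ln (W x y $ a)) = (\<integral>(x, y). V x y $ a * ln (V x y $ a) \<partial>unit_prob2)" for a
    unfolding V by (rule square_integral_eq[OF W, of "\<lambda>P. P $ a * ln (P $ a)"]) measurable
  have "(\<integral>(x, y). entropy3 \<beta> (V x y) \<partial>unit_prob2) =
      (\<integral>p. (\<Sum>a\<in>UNIV. 2 * \<beta> $ a * (\<lambda>(x, y). V x y $ a) p - (\<lambda>(x, y). V x y $ a * ln (V x y $ a)) p) \<partial>unit_prob2)"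
    by (simp add: entropy3_def split_beta')
  also have "\<dots> = (\<Sum>a\<in>UNIV. 2 * \<beta> $ a * (\<integral>(x, y). V x y $ a \<partial>unit_prob2) - (\<integral>(x, y). V x y $ a * ln (V x y $ a) \<partial>unit_prob2))"
    using i1 i2 by (subst Bochner_Integration.integral_sum) (auto intro!: sum.cong)
  also have "\<dots> = 2 * (\<Sum>a\<in>UNIV. \<beta> $ a * square_integral (\<lambda>x y. W x y $ a)) - entropy_fun W"
    by (simp add: s1 s2 entropy_fun_def sum_subtractf sum_distrib_left mult.assoc)
  finally show "(\<integral>(x, y). entropy3 \<beta> (V x y) \<partial>unit_prob2) =
      2 * (\<Sum>a\<in>UNIV. \<beta> $ a * square_integral (\<lambda>x y. W x y $ a)) - entropy_fun W" .
qed

text \<open>The factor 6 serves both parts: three edges, each with a doubled edge functional, and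
  six color orders of equal density in the permanent. The penalty enters with
  \<open>\<kappa>\<close> equal to minus the triangle parameter.\<close>

lemma free_energy_eq_integral:
  assumes W: "W \<in> graphons" and V: "V = graphon_extension W"
  shows "integrable unit_prob3 (\<lambda>(x, y, z). triple_energy \<beta> \<kappa> (V x y) (V y z) (V z x))"
    and "(\<integral>(x, y, z). triple_energy \<beta> \<kappa> (V x y) (V y z) (V z x) \<partial>unit_prob3) =
      6 * (hamiltonian \<beta> (- \<kappa>) W - 1 / 2 * entropy_fun W)"
proof -
  have t: "total_graphon V" using total_graphon_extension[OF W] V by simp
  define E where "E = (\<lambda>(x, y). entropy3 \<beta> (V x y))"
  have iE: "integrable unit_prob2 E" unfolding E_def by (rule entropy3_integral(1)[OF W V])
  have mE: "E \<in> borel_measurable unit_prob2" using iE by simp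
  have sym: "E (y, x) = E (x, y)" for x y using total_graphonD(2)[OF t, of x y] by (simp add: E_def)
  have p: "(\<lambda>(x, y, z). (y, z)) \<in> measurable unit_prob3 unit_prob2"
    "(\<lambda>(x, y, z). (x, z)) \<in> measurable unit_prob3 unit_prob2"
    "(\<lambda>(x, y, z). (x, y)) \<in> measurable unit_prob3 unit_prob2" by measurable
  have i: "integrable unit_prob3 (\<lambda>(x, y, z). E (y, z))" "integrable unit_prob3 (\<lambda>(x, y, z). E (x, z))"
    "integrable unit_prob3 (\<lambda>(x, y, z). E (x, y))"
    using integrable_distr[OF p(1), of E] integrable_distr[OF p(2), of E] integrable_distr[OF p(3), of E] iE
    unfolding measure_preserving_projections by (simp_all add: split_beta')
  let ?p = "\<lambda>(x, y, z). permanent3 (V x y) (V y z) (V z x)"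
  have eq: "(\<lambda>(x, y, z). triple_energy \<beta> \<kappa> (V x y) (V y z) (V z x)) =
    (\<lambda>w. (\<lambda>(x, y, z). E (x, y)) w + (\<lambda>(x, y, z). E (y, z)) w + (\<lambda>(x, y, z). E (x, z)) w - \<kappa> * ?p w)"
    using sym by (auto simp: fun_eq_iff triple_energy_def E_def)
  have ip: "integrable unit_prob3 (\<lambda>w. \<kappa> * ?p w)"
    by (intro integrable_mult_right integral_permanent3(1)[OF t])
  show "integrable unit_prob3 (\<lambda>(x, y, z). triple_energy \<beta> \<kappa> (V x y) (V y z) (V z x))"
    unfolding eq by (intro Bochner_Integration.integrable_add Bochner_Integration.integrable_diff i ip)
  have "(\<integral>(x, y, z). triple_energy \<beta> \<kappa> (V x y) (V y z) (V z x) \<partial>unit_prob3) =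
    (\<integral>(x, y, z). E (x, y) \<partial>unit_prob3) + (\<integral>(x, y, z). E (y, z) \<partial>unit_prob3) + (\<integral>(x, y, z). E (x, z) \<partial>unit_prob3)
     - \<kappa> * (\<integral>w. ?p w \<partial>unit_prob3)"
    unfolding eq
    by (simp only: Bochner_Integration.integral_add Bochner_Integration.integral_diff i ip
        Bochner_Integration.integrable_add integral_mult_right_zero)
  also have "\<dots> = 3 * (\<integral>p. E p \<partial>unit_prob2) - \<kappa> * (6 * color_triangle_density V 1 2 3)"
    unfolding integral_unit_prob3_marginals[OF mE] integral_permanent3(2)[OF t] by simp
  also have "(\<integral>p. E p \<partial>unit_prob2) = 2 * (\<Sum>a\<in>UNIV. \<beta> $ a * square_integral (\<lambda>x y. W x y $ a)) - entropy_fun W"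
    unfolding E_def by (rule entropy3_integral(2)[OF W V])
  also have "color_triangle_density V 1 2 3 = rainbow_density W"
    unfolding color_triangle_density_def by (rule rainbow_density_eq[OF W V, symmetric])
  finally show "(\<integral>(x, y, z). triple_energy \<beta> \<kappa> (V x y) (V y z) (V z x) \<partial>unit_prob3) =
      6 * (hamiltonian \<beta> (- \<kappa>) W - 1 / 2 * entropy_fun W)"
    by (simp add: hamiltonian_def)
qed

lemma free_energy_le:
  assumes W: "W \<in> graphons"
    and B: "\<And>P Q R. P \<in> simplex3 \<Longrightarrow> Q \<in> simplex3 \<Longrightarrow> R \<in> simplex3 \<Longrightarrow> triple_energy \<beta> \<kappa> P Q R \<le> B"
  shows "hamiltonian \<beta> (- \<kappa>) W - 1 / 2 * entropy_fun W \<le> B / 6"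
proof -
  define V where "V = graphon_extension W"
  have t: "total_graphon V" using total_graphon_extension[OF W] V_def by simp
  have "(\<integral>(x, y, z). triple_energy \<beta> \<kappa> (V x y) (V y z) (V z x) \<partial>unit_prob3) \<le> (\<integral>w. B \<partial>unit_prob3)"
    by (intro integral_mono free_energy_eq_integral(1)[OF W V_def]) (auto intro: B total_graphonD[OF t])
  then show ?thesis
    using unit_prob3.prob_space unfolding free_energy_eq_integral(2)[OF W V_def] by simp
qed

text \<open>Only almost everywhere constancy is assumed, since it will be applied to a
  representative chosen from the class of a constant graphon.\<close>

lemma free_energy_const:
  assumes W: "W \<in> graphons" and V: "V = graphon_extension W"
    and ae: "AE p in unit_prob2. (\<lambda>(x, y). V x y) p = P"
  shows "hamiltonian \<beta> (- \<kappa>) W - 1 / 2 * entropy_fun W = triple_energy \<beta> \<kappa> P P P / 6"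
proof -
  have t: "total_graphon V" using total_graphon_extension[OF W] V by simp
  have p: "(\<lambda>(x, y, z). (y, z)) \<in> measurable unit_prob3 unit_prob2"
    "(\<lambda>(x, y, z). (x, z)) \<in> measurable unit_prob3 unit_prob2"
    "(\<lambda>(x, y, z). (x, y)) \<in> measurable unit_prob3 unit_prob2" by measurable
  have "AE w in unit_prob3. (\<lambda>(x, y, z). V y z) w = P" "AE w in unit_prob3. (\<lambda>(x, y, z). V x z) w = P"
    "AE w in unit_prob3. (\<lambda>(x, y, z). V x y) w = P"
    using AE_distrD[OF p(1), of "\<lambda>p. (\<lambda>(x, y). V x y) p = P"] AE_distrD[OF p(2), of "\<lambda>p. (\<lambda>(x, y). V x y) p = P"]
      AE_distrD[OF p(3), of "\<lambda>p. (\<lambda>(x, y). V x y) p = P"] ae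
    unfolding measure_preserving_projections by (simp_all add: split_beta')
  then have "AE w in unit_prob3. (\<lambda>(x, y, z). triple_energy \<beta> \<kappa> (V x y) (V y z) (V z x)) w = triple_energy \<beta> \<kappa> P P P"
    by eventually_elim (use total_graphonD(2)[OF t] in \<open>auto split: prod.splits\<close>)
  then have "(\<integral>w. (\<lambda>(x, y, z). triple_energy \<beta> \<kappa> (V x y) (V y z) (V z x)) w \<partial>unit_prob3) = (\<integral>w. triple_energy \<beta> \<kappa> P P P \<partial>unit_prob3)"
    using free_energy_eq_integral(1)[OF W V] by (intro integral_cong_AE) auto
  then show ?thesis
    using unit_prob3.prob_space unfolding free_energy_eq_integral(2)[OF W V] by simp
qed

section \<open>Stability and the cut distance\<close>

lemma (in pair_prob_space) exists_small_slice:
  assumes A: "A \<in> sets (M1 \<Otimes>\<^sub>M M2)" and lt: "P.prob A < \<kappa>"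
  shows "\<exists>x\<in>space M1. M2.prob (Pair x -` A) < \<kappa>"
proof (rule ccontr)
  assume "\<not> ?thesis"
  then have ge: "\<kappa> \<le> M2.prob (Pair x -` A)" if "x \<in> space M1" for x using that by force
  have "ennreal \<kappa> = (\<integral>\<^sup>+x. ennreal \<kappa> \<partial>M1)" by (simp add: M1.emeasure_space_1)
  also have "\<dots> \<le> (\<integral>\<^sup>+x. emeasure M2 (Pair x -` A) \<partial>M1)"
    using ge by (intro nn_integral_mono) (simp add: M2.emeasure_eq_measure)
  also have "\<dots> = emeasure (M1 \<Otimes>\<^sub>M M2) A" by (rule M2.emeasure_pair_measure_alt[OF A, symmetric])
  finally have "\<kappa> \<le> P.prob A" by (simp add: P.emeasure_eq_measure)
  then show False using lt by simp
qed

definition near_common_color :: "real ^ 3 \<Rightarrow> real \<Rightarrow> real ^ 3 \<Rightarrow> real ^ 3 \<Rightarrow> real ^ 3 \<Rightarrow> bool" where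
  "near_common_color \<beta> \<epsilon> P Q R \<longleftrightarrow> (\<exists>p\<in>optimal_pairs \<beta>. P \<in> ball (two_color_vec \<beta> p) \<epsilon> \<and>
     Q \<in> ball (two_color_vec \<beta> p) \<epsilon> \<and> R \<in> ball (two_color_vec \<beta> p) \<epsilon>)"

definition bad_triples :: "real ^ 3 \<Rightarrow> real \<Rightarrow> kernel3 \<Rightarrow> (real \<times> real \<times> real) set" where
  "bad_triples \<beta> \<epsilon> V = {(x, y, z). \<not> near_common_color \<beta> \<epsilon> (V x y) (V y z) (V z x)}"

lemma bad_triples_sets:
  assumes "total_graphon V"
  shows "bad_triples \<beta> \<epsilon> V \<in> sets unit_prob3"
proof -
  let ?f = "\<lambda>(x, y, z). V x y" and ?g = "\<lambda>(x, y, z). V y z" and ?h = "\<lambda>(x, y, z). V z x"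
  let ?B = "\<lambda>p. ball (two_color_vec \<beta> p) \<epsilon>"
  have m: "?f -` ?B p \<inter> space unit_prob3 \<in> sets unit_prob3" "?g -` ?B p \<inter> space unit_prob3 \<in> sets unit_prob3"
    "?h -` ?B p \<inter> space unit_prob3 \<in> sets unit_prob3" for p
    by (rule measurable_sets[OF total_graphon_triple_measurable(1)[OF assms]], simp)
       (rule measurable_sets[OF total_graphon_triple_measurable(2)[OF assms]], simp,
        rule measurable_sets[OF total_graphon_triple_measurable(3)[OF assms]], simp)
  have "bad_triples \<beta> \<epsilon> V = space unit_prob3 - (\<Union>p\<in>optimal_pairs \<beta>.
      (?f -` ?B p \<inter> space unit_prob3) \<inter> (?g -` ?B p \<inter> space unit_prob3) \<inter> (?h -` ?B p \<inter> space unit_prob3))"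
    by (auto simp: bad_triples_def near_common_color_def space_pair_measure)
  also have "\<dots> \<in> sets unit_prob3"
    by (intro sets.Diff sets.top sets.finite_UN finite_optimal_pairs sets.Int m)
  finally show ?thesis .
qed

text \<open>A Markov-type estimate: the energy is at most \<open>c + \<eta>\<close> everywhere and
  below \<open>c - \<delta>\<close> on bad triples, while its mean is at least \<open>c\<close>;
  hence the bad set has probability at most \<open>\<eta> / (\<delta> + \<eta>)\<close>.\<close>

lemma prob_bad_triples_le:
  assumes W: "W \<in> graphons" and V: "V = graphon_extension W" and pos: "0 < \<delta>" "0 \<le> \<eta>"
    and upper: "\<And>P Q R. P \<in> simplex3 \<Longrightarrow> Q \<in> simplex3 \<Longrightarrow> R \<in> simplex3 \<Longrightarrow> triple_energy \<beta> \<kappa> P Q R \<le> c + \<eta>"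
    and stable: "\<And>P Q R. P \<in> simplex3 \<Longrightarrow> Q \<in> simplex3 \<Longrightarrow> R \<in> simplex3 \<Longrightarrow>
      c - \<delta> \<le> triple_energy \<beta> \<kappa> P Q R \<Longrightarrow> near_common_color \<beta> \<epsilon> P Q R"
    and lower: "c / 6 \<le> hamiltonian \<beta> (- \<kappa>) W - 1 / 2 * entropy_fun W"
  shows "unit_prob3.P.prob (bad_triples \<beta> \<epsilon> V) \<le> \<eta> / \<delta>"
proof -
  have t: "total_graphon V" using total_graphon_extension[OF W] V by simp
  let ?A = "bad_triples \<beta> \<epsilon> V"
  note A = bad_triples_sets[OF t, of \<beta> \<epsilon>]
  let ?g = "\<lambda>(x, y, z). triple_energy \<beta> \<kappa> (V x y) (V y z) (V z x)"
  have "?g w \<le> c + \<eta> - (\<delta> + \<eta>) * indicator ?A w" for w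
  proof (cases "w \<in> ?A")
    case True
    obtain x y z where w: "w = (x, y, z)" using prod_cases3 by blast
    then have "\<not> near_common_color \<beta> \<epsilon> (V x y) (V y z) (V z x)" using True by (simp add: bad_triples_def)
    then have "triple_energy \<beta> \<kappa> (V x y) (V y z) (V z x) < c - \<delta>"
      using stable total_graphonD(1)[OF t] not_le by blast
    then show ?thesis using True w by simp
  next
    case False
    then show ?thesis using upper total_graphonD(1)[OF t] by (simp split: prod.splits)
  qed
  then have "(\<integral>w. ?g w \<partial>unit_prob3) \<le> (\<integral>w. c + \<eta> - (\<delta> + \<eta>) * indicator ?A w \<partial>unit_prob3)"
    using A by (intro integral_mono free_energy_eq_integral(1)[OF W V]) (auto simp: unit_prob3.P.emeasure_eq_measure)
  also have "\<dots> = c + \<eta> - (\<delta> + \<eta>) * unit_prob3.P.prob ?A"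
    using A unit_prob3.P.prob_space
    by (subst Bochner_Integration.integral_diff) (auto simp: unit_prob3.P.emeasure_eq_measure)
  finally have "(\<delta> + \<eta>) * unit_prob3.P.prob ?A \<le> \<eta>"
    using lower unfolding free_energy_eq_integral(2)[OF W V] by simp
  moreover have "\<delta> * unit_prob3.P.prob ?A \<le> (\<delta> + \<eta>) * unit_prob3.P.prob ?A"
    using pos by (intro mult_right_mono) auto
  ultimately show ?thesis using pos by (simp add: pos_le_divide_eq mult.commute)
qed

text \<open>Distinct pairs have distinct supports: some color has probability at least
  \<open>2 * m\<close> in one distribution and 0 in the other, so no vector is within
  \<open>m\<close> of both. This lets a good triple determine its pair uniquely.\<close>

lemma two_color_vec_separated:
  obtains \<epsilon> where "0 < \<epsilon>" "\<And>p q P. p \<in> color_pairs \<Longrightarrow> q \<in> color_pairs \<Longrightarrow>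
    P \<in> ball (two_color_vec \<beta> p) \<epsilon> \<Longrightarrow> P \<in> ball (two_color_vec \<beta> q) \<epsilon> \<Longrightarrow> p = q"
proof -
  obtain m where m: "0 < m" "\<And>a b. (a, b) \<in> color_pairs \<Longrightarrow>
      2 * m \<le> two_color_vec \<beta> (a, b) $ a \<and> 2 * m \<le> two_color_vec \<beta> (a, b) $ b"
    using two_color_vec_lower[of \<beta>] by metis
  have sub: "a \<in> {a', b'} \<and> b \<in> {a', b'}"
    if p: "(a, b) \<in> color_pairs" "(a', b') \<in> color_pairs"
      and P: "P \<in> ball (two_color_vec \<beta> (a, b)) m" "P \<in> ball (two_color_vec \<beta> (a', b')) m" for a b a' b' P
  proof -
    have "i \<in> {a', b'}" if i: "i \<in> {a, b}" for i
    proof (rule ccontr)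
      assume "i \<notin> {a', b'}"
      then have "two_color_vec \<beta> (a', b') $ i = 0" by (simp add: two_color_vec_nth)
      moreover have "2 * m \<le> two_color_vec \<beta> (a, b) $ i" using m(2)[OF p(1)] i by auto
      ultimately show False
        using component_diff_less_of_ball[OF P(1), of i] component_diff_less_of_ball[OF P(2), of i] by linarith
    qed
    then show ?thesis by blast
  qed
  show ?thesis
  proof (rule that[OF m(1)])
    fix p q P
    assume h: "p \<in> color_pairs" "q \<in> color_pairs" "P \<in> ball (two_color_vec \<beta> p) m" "P \<in> ball (two_color_vec \<beta> q) m"
    obtain a b a' b' where pq: "p = (a, b)" "q = (a', b')" by fastforce
    have "a \<in> {a', b'} \<and> b \<in> {a', b'}" using sub h unfolding pq by blast
    then show "p = q" using h(1,2) unfolding pq color_pairs_def by auto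
  qed
qed

text \<open>Fix \<open>x\<close> in few bad triples, then \<open>y\<close> such that \<open>(x, y)\<close> is in few. The color pair of the edge \<open>xy\<close> propagates
  through good triples \<open>(x, y, z)\<close> to almost all edges \<open>xz\<close>, and from these to almost all edges.\<close>

lemma exists_common_color:
  assumes t: "total_graphon V" and lt: "unit_prob3.P.prob (bad_triples \<beta> \<epsilon> V) < \<kappa>" and \<kappa>: "\<kappa> \<le> 1"
    and sep: "\<And>p q P. p \<in> color_pairs \<Longrightarrow> q \<in> color_pairs \<Longrightarrow>
      P \<in> ball (two_color_vec \<beta> p) \<epsilon> \<Longrightarrow> P \<in> ball (two_color_vec \<beta> q) \<epsilon> \<Longrightarrow> p = q"
  shows "\<exists>p\<in>optimal_pairs \<beta>. unit_prob2.P.prob {(x, y). V x y \<notin> ball (two_color_vec \<beta> p) \<epsilon>} \<le> 2 * \<kappa>"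
proof -
  let ?B = "\<lambda>p. ball (two_color_vec \<beta> p) \<epsilon>"
  let ?A = "bad_triples \<beta> \<epsilon> V"
  note A = bad_triples_sets[OF t, of \<beta> \<epsilon>]
  have sep': "p = q" if "p \<in> optimal_pairs \<beta>" "q \<in> optimal_pairs \<beta>" "P \<in> ?B p" "P \<in> ?B q" for p q P
    using sep that by (auto simp: optimal_pairs_iff)
  obtain x where x: "unit_prob2.P.prob (Pair x -` ?A) < \<kappa>"
    using unit_prob3.exists_small_slice[OF A lt] by blast
  define B1 where "B1 = Pair x -` ?A"
  have B1: "B1 \<in> sets unit_prob2" unfolding B1_def by (rule sets_Pair1[OF A])
  obtain y where y: "unit_prob.prob (Pair y -` B1) < \<kappa>"
    using unit_prob2.exists_small_slice[OF B1] x B1_def by blast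
  define B2 where "B2 = Pair y -` B1"
  have B2: "B2 \<in> sets unit_prob" unfolding B2_def by (rule sets_Pair1[OF B1])
  have good1: "near_common_color \<beta> \<epsilon> (V x y') (V y' z) (V z x)" if "(y', z) \<notin> B1" for y' z
    using that by (simp add: B1_def bad_triples_def)
  \<comment> \<open>One good triangle on the edge \<open>xy\<close> suffices to read off its color
    pair; \<open>\<kappa> \<le> 1\<close> guarantees that there is one.\<close>
  have "B2 \<noteq> UNIV"
    using y \<kappa> unit_prob.prob_space unfolding B2_def by auto
  then obtain z0 where "z0 \<notin> B2" by blast
  then obtain p where p: "p \<in> optimal_pairs \<beta>" and xy: "V x y \<in> ?B p"
    using good1[of y z0] unfolding B2_def near_common_color_def by auto
  have row: "V z x \<in> ?B p" if z: "z \<notin> B2" for z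
  proof -
    obtain q where q: "q \<in> optimal_pairs \<beta>" "V x y \<in> ?B q" "V z x \<in> ?B q"
      using good1[of y z] z unfolding B2_def near_common_color_def by auto
    then show ?thesis using sep'[OF q(1) p q(2) xy] by simp
  qed
  have all: "V y' z \<in> ?B p" if yz: "(y', z) \<notin> B1" "y' \<notin> B2" for y' z
  proof -
    obtain q where q: "q \<in> optimal_pairs \<beta>" "V x y' \<in> ?B q" "V y' z \<in> ?B q"
      using good1[OF yz(1)] unfolding near_common_color_def by auto
    have "V x y' \<in> ?B p" using row[OF yz(2)] total_graphonD(2)[OF t, of x y'] by simp
    then show ?thesis using sep'[OF q(1) p q(2)] q(3) by simp
  qed
  \<comment> \<open>An edge \<open>(y', z)\<close> escapes only if the triangle
    \<open>(x, y', z)\<close> is bad, or if the edge \<open>xy'\<close> was not reached because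
    \<open>y'\<close> lies in \<open>B2\<close>; each event has probability below
    \<open>\<kappa>\<close>.\<close>
  have "unit_prob2.P.prob {(x, y). V x y \<notin> ?B p} \<le> unit_prob2.P.prob (B1 \<union> B2 \<times> UNIV)"
    using all B1 B2 by (intro unit_prob2.P.finite_measure_mono sets.Un pair_measureI) auto
  also have "\<dots> \<le> unit_prob2.P.prob B1 + unit_prob2.P.prob (B2 \<times> UNIV)"
    using B1 B2 by (intro measure_Un_le pair_measureI) auto
  also have "unit_prob2.P.prob (B2 \<times> UNIV) = unit_prob.prob B2"
    using B2 unit_prob.emeasure_space_1 by (simp add: measure_def unit_prob.emeasure_pair_measure_Times)
  finally show ?thesis using x y p unfolding B1_def[symmetric] B2_def[symmetric] by force
qed

section \<open>Bounds for the cut norm and the cut distance\<close>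

text \<open>Bounds the family under the supremum in \<open>cut_norm\<close>; a real supremum says
  nothing about its members unless the family is bounded.\<close>

lemma cut_norm_integral_le:
  fixes U :: kernel
  assumes U: "\<And>x y. x \<in> {0..1} \<Longrightarrow> y \<in> {0..1} \<Longrightarrow> \<bar>U x y\<bar> \<le> 1"
    and ST: "S \<in> sets borel" "T \<in> sets borel" "S \<subseteq> {0..1}" "T \<subseteq> {0..1}"
  shows "\<bar>set_lebesgue_integral lborel (S \<times> T) (\<lambda>(x, y). U x y)\<bar> \<le> (1 :: real)"
proof (cases "set_integrable lborel (S \<times> T) (\<lambda>(x, y). U x y)")
  \<comment> \<open>Without integrability the integral is 0 by convention.\<close>
  case False
  then show ?thesis
    by (simp add: set_lebesgue_integral_def set_integrable_def not_integrable_integral_eq)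
next
  case True
  have sq: "({0..1::real} \<times> {0..1::real}) \<in> sets lborel" by (simp add: borel_closed closed_Times)
  have e: "emeasure lborel ({0..1::real} \<times> {0..1::real}) = 1"
    unfolding lborel_prod[symmetric] by (subst lborel.emeasure_pair_measure_Times) auto
  have i: "integrable lborel (indicator ({0..1::real} \<times> {0..1::real}) :: _ \<Rightarrow> real)"
    using sq e by (intro integrable_real_indicator) auto
  have "\<bar>set_lebesgue_integral lborel (S \<times> T) (\<lambda>(x, y). U x y)\<bar> \<le>
      (\<integral>p. norm (indicator (S \<times> T) p *\<^sub>R (\<lambda>(x, y). U x y) p) \<partial>lborel)"
    unfolding set_lebesgue_integral_def real_norm_def[symmetric] by (rule integral_norm_bound)
  also have "\<dots> \<le> (\<integral>p. indicator ({0..1::real} \<times> {0..1::real}) p \<partial>lborel)"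
  proof (rule Bochner_Integration.integral_mono)
    show "integrable lborel (\<lambda>p. norm (indicator (S \<times> T) p *\<^sub>R (\<lambda>(x, y). U x y) p))"
      using True unfolding set_integrable_def by (rule integrable_norm)
    fix p :: "real \<times> real"
    have "S \<times> T \<subseteq> {0..1} \<times> {0..1}" using ST by blast
    then show "norm (indicator (S \<times> T) p *\<^sub>R (\<lambda>(x, y). U x y) p) \<le> indicator ({0..1} \<times> {0..1}) p"
      using U[of "fst p" "snd p"] by (cases "p \<in> S \<times> T") (auto simp: split_beta mem_Times_iff indicator_def)
  qed (rule i)
  also have "\<dots> = 1" using sq e by (simp add: measure_def)
  finally show ?thesis .
qed

lemma cut_norm_upper:
  fixes U :: kernel
  assumes U: "\<And>x y. x \<in> {0..1} \<Longrightarrow> y \<in> {0..1} \<Longrightarrow> \<bar>U x y\<bar> \<le> 1"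
    and ST: "S \<in> sets borel" "T \<in> sets borel" "S \<subseteq> {0..1}" "T \<subseteq> {0..1}"
  shows "\<bar>set_lebesgue_integral lborel (S \<times> T) (\<lambda>(x, y). U x y)\<bar> \<le> cut_norm U"
proof -
  let ?I = "{(S, T). S \<in> sets borel \<and> T \<in> sets borel \<and> S \<subseteq> {0..1::real} \<and> T \<subseteq> {0..1::real}}"
  let ?f = "\<lambda>(S, T). \<bar>set_lebesgue_integral lborel (S \<times> T) (\<lambda>(x, y). U x y)\<bar>"
  have "bdd_above (?f ` ?I)"
    by (rule bdd_aboveI[where M = 1]) (auto intro!: cut_norm_integral_le U)
  then have "?f (S, T) \<le> (SUP p\<in>?I. ?f p)" using ST by (intro cSUP_upper) auto
  then show ?thesis by (simp add: cut_norm_def)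
qed

lemma cut_norm_nonneg:
  assumes "\<And>x y. x \<in> {0..1} \<Longrightarrow> y \<in> {0..1} \<Longrightarrow> \<bar>U x y\<bar> \<le> 1"
  shows "0 \<le> cut_norm U"
proof -
  have "\<bar>set_lebesgue_integral lborel ({} \<times> {}) (\<lambda>(x, y). U x y)\<bar> \<le> cut_norm U"
    by (rule cut_norm_upper) (auto simp: assms)
  then show ?thesis by simp
qed

lemma cut_norm_le:
  assumes "\<And>S T. S \<in> sets borel \<Longrightarrow> T \<in> sets borel \<Longrightarrow> S \<subseteq> {0..1} \<Longrightarrow> T \<subseteq> {0..1} \<Longrightarrow>
    \<bar>set_lebesgue_integral lborel (S \<times> T) (\<lambda>(x, y). U x y)\<bar> \<le> c"
  shows "cut_norm U \<le> c"
proof -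
  let ?I = "{(S, T). S \<in> sets borel \<and> T \<in> sets borel \<and> S \<subseteq> {0..1::real} \<and> T \<subseteq> {0..1::real}}"
  have ne: "?I \<noteq> {}" by (rule notI) (drule equals0D[of _ "({}, {})"], simp)
  have "(\<lambda>(S, T). \<bar>set_lebesgue_integral lborel (S \<times> T) (\<lambda>(x, y). U x y)\<bar>) p \<le> c" if "p \<in> ?I" for p
    using that by (cases p) (simp add: assms)
  then show ?thesis
    unfolding cut_norm_def by (intro cSUP_least[OF ne])
qed

lemma simplex3_diff_le: "P \<in> simplex3 \<Longrightarrow> Q \<in> simplex3 \<Longrightarrow> \<bar>(P - Q) $ a\<bar> \<le> 1"
  using simplex3D(1,2)[of P a] simplex3D(1,2)[of Q a] by (simp add: abs_le_iff)

lemma graphonsD: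
  assumes "W \<in> graphons" "x \<in> {0..1}" "y \<in> {0..1}"
  shows "W x y \<in> simplex3"
  using assms by (auto simp: graphons_def)

lemma mp_bijectionsD:
  assumes "\<phi> \<in> mp_bijections" "x \<in> {0..1}"
  shows "\<phi> x \<in> {0..1}"
  using assms by (auto simp: mp_bijections_def dest: bij_betwE)

lemma id_mp_bijections: "(\<lambda>x. x) \<in> mp_bijections"
proof -
  have "the_inv_into {0..1} (\<lambda>x::real. x) \<in> measurable unit_measure unit_measure \<longleftrightarrow>
      (\<lambda>x. x) \<in> measurable unit_measure unit_measure"
    by (rule measurable_cong) (simp add: the_inv_into_f_f[of "\<lambda>x. x", simplified] space_restrict_space)
  moreover have "distr unit_measure unit_measure (\<lambda>x. x) = unit_measure" by (rule distr_id)
  ultimately show ?thesis by (simp add: mp_bijections_def bij_betw_def)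
qed

lemma cut_norm3_diff_nonneg:
  assumes "U \<in> graphons" "W \<in> graphons" "\<phi> \<in> mp_bijections"
  shows "0 \<le> cut_norm3 (\<lambda>x y. U x y - W (\<phi> x) (\<phi> y))"
  unfolding cut_norm3_def
proof (rule sum_nonneg, rule cut_norm_nonneg)
  fix a x y assume xy: "x \<in> {0..1::real}" "y \<in> {0..1::real}"
  show "\<bar>(U x y - W (\<phi> x) (\<phi> y)) $ a\<bar> \<le> 1"
    using graphonsD[OF assms(1) xy] graphonsD[OF assms(2) mp_bijectionsD[OF assms(3) xy(1)] mp_bijectionsD[OF assms(3) xy(2)]]
    by (rule simplex3_diff_le)
qed

lemma cut_dist_nonneg:
  assumes "U \<in> graphons" "W \<in> graphons"
  shows "0 \<le> cut_dist U W"
  unfolding cut_dist_def using id_mp_bijections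
  by (intro cINF_greatest cut_norm3_diff_nonneg assms) auto

lemma cut_dist_le_cut_norm3:
  assumes "U \<in> graphons" "W \<in> graphons"
  shows "cut_dist U W \<le> cut_norm3 (\<lambda>x y. U x y - W x y)"
  unfolding cut_dist_def
  by (rule order_trans[OF cINF_lower[OF _ id_mp_bijections]])
     (auto intro!: bdd_belowI2[where m = 0] cut_norm3_diff_nonneg assms)

lemma cut_norm_zero: "cut_norm (\<lambda>x y. 0) = 0"
proof (rule antisym)
  show "cut_norm (\<lambda>x y. 0) \<le> 0"
    by (rule cut_norm_le) (simp add: set_lebesgue_integral_def split_beta')
qed (rule cut_norm_nonneg, simp)

lemma cut_dist_self: "W \<in> graphons \<Longrightarrow> cut_dist W W = 0"
  using cut_dist_le_cut_norm3[of W W] cut_dist_nonneg[of W W] by (simp add: cut_norm3_def cut_norm_zero)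

text \<open>Reflexivity of \<open>cut_rel\<close> makes every class nonempty, so the choice in
  \<open>rep\<close> yields a genuine element.\<close>

lemma rep_graphon_class:
  assumes "C \<in> graphon_classes"
  shows "rep C \<in> graphons" "rep C \<in> C"
proof -
  obtain W where W: "W \<in> graphons" "C = cut_rel `` {W}"
    using assms by (auto simp: graphon_classes_def quotient_def)
  then have "W \<in> C" using cut_dist_self by (simp add: cut_rel_def)
  then show mem: "rep C \<in> C" unfolding rep_def by (rule someI[of "\<lambda>W. W \<in> C"])
  show "rep C \<in> graphons" using W mem by (auto simp: cut_rel_def)
qed

lemma graphon_class_mem: "W \<in> graphons \<Longrightarrow> graphon_class W \<in> graphon_classes"
  by (auto simp: graphon_class_def graphon_classes_def intro: quotientI)

lemma AE_unit_prob2: "AE p in unit_prob2. p \<in> {0..1} \<times> {0..1}"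
  unfolding unit_prob2_eq
  by (subst AE_density) (auto simp: indicator_def intro!: borel_measurable_indicator borel_closed closed_Times)

lemma rectangle_integral_eq:
  fixes f g :: "real \<times> real \<Rightarrow> real"
  assumes ST: "S \<in> sets borel" "T \<in> sets borel" "S \<subseteq> {0..1}" "T \<subseteq> {0..1}"
    and g: "g \<in> borel_measurable borel" and eq: "\<And>p. p \<in> {0..1} \<times> {0..1} \<Longrightarrow> f p = g p"
  shows "set_lebesgue_integral lborel (S \<times> T) f = (\<integral>p. indicator (S \<times> T) p * g p \<partial>unit_prob2)"
proof -
  have sub: "S \<times> T \<subseteq> {0..1} \<times> {0..1}" using ST by blast
  have "S \<times> T \<in> sets (borel \<Otimes>\<^sub>M borel)" using ST by (intro pair_measureI) auto
  then have m: "(\<lambda>p. indicator (S \<times> T) p * g p) \<in> borel_measurable borel"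
    using g unfolding borel_prod by (intro borel_measurable_times borel_measurable_indicator)
  have "set_lebesgue_integral lborel (S \<times> T) f =
      set_lebesgue_integral lborel ({0..1} \<times> {0..1}) (\<lambda>p. indicator (S \<times> T) p * f p)"
    unfolding set_lebesgue_integral_def using sub
    by (intro Bochner_Integration.integral_cong) (auto simp: indicator_def)
  also have "\<dots> = (\<integral>p. indicator (S \<times> T) p * g p \<partial>unit_prob2)"
    unfolding unit_prob2_eq
    by (rule set_lebesgue_integral_eq_density[OF _ m]) (auto simp: eq intro!: borel_closed closed_Times)
  finally show ?thesis .
qed

text \<open>The cut norm is bounded by the integral of the absolute value: each component differs by
  at most \<open>\<epsilon>\<close> off a set of probability \<open>\<theta>\<close>, and by at most
  1 on it. The factor 3 counts the colors.\<close>

lemma cut_norm3_diff_le: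
  assumes W: "W \<in> graphons" and V: "V = graphon_extension W"
    and W': "W' \<in> graphons" and V': "V' = graphon_extension W'"
    and P: "P \<in> simplex3" and ae: "AE p in unit_prob2. (\<lambda>(x, y). V' x y) p = P" and \<epsilon>: "0 < \<epsilon>"
    and prob: "unit_prob2.P.prob {(x, y). V x y \<notin> ball P \<epsilon>} \<le> \<theta>"
  shows "cut_norm3 (\<lambda>x y. W x y - W' x y) \<le> 3 * (\<epsilon> + \<theta>)"
proof -
  have t: "total_graphon V" "total_graphon V'"
    using total_graphon_extension[OF W] total_graphon_extension[OF W'] V V' by simp_all
  have m: "(\<lambda>(x, y). V x y) \<in> borel_measurable borel" "(\<lambda>(x, y). V' x y) \<in> borel_measurable borel"
    using t by (auto simp: total_graphon_def)
  have "cut_norm (\<lambda>x y. (W x y - W' x y) $ a) \<le> \<epsilon> + \<theta>" for a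
  proof (rule cut_norm_le)
    fix S T :: "real set"
    assume ST: "S \<in> sets borel" "T \<in> sets borel" "S \<subseteq> {0..1}" "T \<subseteq> {0..1}"
    let ?A = "{(x, y). V x y \<notin> ball P \<epsilon>}"
    have "?A = (\<lambda>(x, y). V x y) -` (- ball P \<epsilon>) \<inter> space unit_prob2"
      by (auto simp: space_pair_measure)
    also have "\<dots> \<in> sets unit_prob2"
      by (rule measurable_sets[OF total_graphon_triple_measurable(4)[OF t(1)]]) simp
    finally have A: "?A \<in> sets unit_prob2" .
    let ?g = "\<lambda>(x, y). (V x y - V' x y) $ a"
    have g: "?g \<in> borel_measurable borel"
      using measurable_compose[OF borel_measurable_diff[OF m] borel_measurable_nth[of a]] by (simp add: split_beta')
    have "set_lebesgue_integral lborel (S \<times> T) (\<lambda>(x, y). (W x y - W' x y) $ a) =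
        (\<integral>p. indicator (S \<times> T) p * ?g p \<partial>unit_prob2)"
      by (rule rectangle_integral_eq[OF ST g]) (auto simp: V V' graphon_extension_eq)
    also have "\<bar>\<dots>\<bar> \<le> (\<integral>p. \<epsilon> + indicator ?A p \<partial>unit_prob2)"
      unfolding real_norm_def[symmetric]
    proof (rule order_trans[OF integral_norm_bound integral_mono_AE'])
      show "AE p in unit_prob2. 0 \<le> \<epsilon> + indicator ?A p" using \<epsilon> by simp
      show "integrable unit_prob2 (\<lambda>p. \<epsilon> + indicator ?A p :: real)"
        using A by (intro Bochner_Integration.integrable_add integrable_real_indicator)
          (auto simp: unit_prob2.P.emeasure_eq_measure)
      show "AE p in unit_prob2. norm (indicator (S \<times> T) p * ?g p) \<le> \<epsilon> + indicator ?A p"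
        using ae
      proof eventually_elim
        case (elim p)
        obtain x y where p: "p = (x, y)" by fastforce
        have "\<bar>(V x y - P) $ a\<bar> \<le> \<epsilon> + indicator ?A (x, y)"
        proof (cases "V x y \<in> ball P \<epsilon>")
          case True
          then show ?thesis using component_diff_less_of_ball[OF True, of a] by simp
        next
          case False
          then show ?thesis using simplex3_diff_le[OF total_graphonD(1)[OF t(1)] P, of x y a] \<epsilon> by simp
        qed
        then show ?case using elim \<epsilon> by (auto simp: p abs_mult indicator_def)
      qed
    qed
    also have "\<dots> = \<epsilon> + unit_prob2.P.prob ?A"
      using A unit_prob2.P.prob_space
      by (subst Bochner_Integration.integral_add) (auto simp: unit_prob2.P.emeasure_eq_measure)
    finally show "\<bar>set_lebesgue_integral lborel (S \<times> T) (\<lambda>(x, y). (W x y - W' x y) $ a)\<bar> \<le> \<epsilon> + \<theta>"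
      using prob by simp
  qed
  then have "cut_norm3 (\<lambda>x y. W x y - W' x y) \<le> (\<Sum>a\<in>(UNIV :: 3 set). \<epsilon> + \<theta>)"
    unfolding cut_norm3_def by (intro sum_mono)
  then show ?thesis by simp
qed

text \<open>The value \<open>2\<close> outside \<open>[0,1]\<close> makes preimages of subsets of \<open>[0,1]\<close> subsets of \<open>[0,1]\<close>.\<close>

definition extend_bijection :: "(real \<Rightarrow> real) \<Rightarrow> real \<Rightarrow> real" where
  "extend_bijection \<phi> x = (if x \<in> {0..1} then \<phi> x else 2)"

lemma measurable_extend_bijection:
  assumes "\<phi> \<in> mp_bijections"
  shows "extend_bijection \<phi> \<in> borel_measurable borel"
proof -
  have "\<phi> \<in> measurable unit_measure unit_measure" using assms by (simp add: mp_bijections_def)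
  then have "\<phi> \<in> measurable (restrict_space lborel {0..1}) lborel"
    by (simp add: measurable_restrict_space2_iff)
  then have "(\<lambda>x. if x \<in> {0..1} then \<phi> x else 2) \<in> measurable lborel lborel"
    by (subst (asm) measurable_restrict_space_iff[where c = 2]) auto
  then show ?thesis by (simp add: extend_bijection_def[abs_def])
qed

lemma distr_extend_bijection:
  assumes \<phi>: "\<phi> \<in> mp_bijections"
  shows "distr unit_prob unit_prob (extend_bijection \<phi>) = unit_prob"
proof (rule measure_eqI)
  let ?\<phi> = "extend_bijection \<phi>"
  have m: "?\<phi> \<in> measurable unit_prob unit_prob"
    using measurable_extend_bijection[OF \<phi>] by (simp add: measurable_cong_sets[OF sets_unit_prob sets_unit_prob])
  have \<phi>m: "\<phi> \<in> measurable unit_measure unit_measure" and \<phi>d: "distr unit_measure unit_measure \<phi> = unit_measure"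
    using \<phi> by (auto simp: mp_bijections_def)
  fix A assume "A \<in> sets (distr unit_prob unit_prob ?\<phi>)"
  then have A: "A \<in> sets borel" by simp
  then have A01: "{0..1} \<inter> A \<in> sets unit_measure"
    by (subst sets_restrict_space_iff) auto
  have pre: "\<phi> -` ({0..1} \<inter> A) \<inter> {0..1} = {0..1} \<inter> ?\<phi> -` A"
    using mp_bijectionsD[OF \<phi>] by (auto simp: extend_bijection_def)
  have "emeasure (distr unit_prob unit_prob ?\<phi>) A = emeasure unit_prob (?\<phi> -` A)"
    using emeasure_distr[OF m] A by simp
  also have "\<dots> = emeasure lborel ({0..1} \<inter> ?\<phi> -` A)"
    using measurable_sets[OF measurable_extend_bijection[OF \<phi>] A] by (intro emeasure_unit_prob) simp
  also have "\<dots> = emeasure unit_measure (\<phi> -` ({0..1} \<inter> A) \<inter> {0..1})"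
    unfolding pre by (subst emeasure_restrict_space) auto
  also have "\<dots> = emeasure (distr unit_measure unit_measure \<phi>) ({0..1} \<inter> A)"
    using emeasure_distr[OF \<phi>m A01] by (simp add: space_restrict_space)
  also have "\<dots> = emeasure lborel ({0..1} \<inter> A)"
    unfolding \<phi>d by (subst emeasure_restrict_space) auto
  also have "\<dots> = emeasure unit_prob A" using A by (rule emeasure_unit_prob[symmetric])
  finally show "emeasure (distr unit_prob unit_prob ?\<phi>) A = emeasure unit_prob A" .
qed simp

section \<open>Graphons at cut distance zero from a constant\<close>

text \<open>Relabelling leaves the constant \<open>P\<close> unchanged, so the discrepancy of
  \<open>V\<close> from \<open>P\<close> on \<open>S \<times> T\<close> equals that of the
  relabelled graphon on the preimages of \<open>S\<close> and \<open>T\<close>. The bound holds for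
  every \<open>\<phi>\<close> with a left side free of \<open>\<phi>\<close>, and so passes to the
  infimum, attained or not.\<close>

lemma rectangle_integral_le_cut_norm3:
  assumes P: "P \<in> simplex3" and W: "W \<in> graphons" and V: "V = graphon_extension W" and \<phi>: "\<phi> \<in> mp_bijections"
    and ST: "S \<in> sets borel" "T \<in> sets borel" "S \<subseteq> {0..1}" "T \<subseteq> {0..1}"
  shows "\<bar>\<integral>p. indicator (S \<times> T) p * (\<lambda>(x, y). (P - V x y) $ a) p \<partial>unit_prob2\<bar> \<le>
    cut_norm3 (\<lambda>x y. P - W (\<phi> x) (\<phi> y))"
proof -
  have t: "total_graphon V" using total_graphon_extension[OF W] V by simp
  let ?\<phi> = "extend_bijection \<phi>"
  note m = measurable_extend_bijection[OF \<phi>]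
  have mN: "?\<phi> \<in> measurable unit_prob unit_prob"
    using m by (simp add: measurable_cong_sets[OF sets_unit_prob sets_unit_prob])
  let ?S = "?\<phi> -` S" and ?T = "?\<phi> -` T"
  have ST': "?S \<in> sets borel" "?T \<in> sets borel" "?S \<subseteq> {0..1}" "?T \<subseteq> {0..1}"
    using measurable_sets[OF m ST(1)] measurable_sets[OF m ST(2)] ST(3,4)
    by (auto simp: extend_bijection_def split: if_splits)
  let ?g = "\<lambda>(x, y). (P - V x y) $ a"
  let ?h = "\<lambda>p. indicator (S \<times> T) p * ?g p"
  have g: "?g \<in> borel_measurable borel"
  proof -
    have "(\<lambda>(x, y). V x y) \<in> borel_measurable borel" using t by (simp add: total_graphon_def)
    from measurable_compose[OF borel_measurable_diff[OF borel_measurable_const[of P] this] borel_measurable_nth[of a]]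
    show ?thesis by (simp add: split_beta')
  qed
  have "S \<times> T \<in> sets (borel \<Otimes>\<^sub>M borel)" using ST by (intro pair_measureI) auto
  then have "?h \<in> borel_measurable borel"
    using g unfolding borel_prod by (intro borel_measurable_times borel_measurable_indicator)
  then have h: "?h \<in> borel_measurable unit_prob2"
    by (simp add: measurable_cong_sets[OF sets_unit_prob2 refl])
  have mp: "(\<lambda>(x, y). (?\<phi> x, ?\<phi> y)) \<in> measurable unit_prob2 unit_prob2"
    unfolding split_beta'
    by (intro measurable_Pair measurable_compose[OF measurable_fst mN] measurable_compose[OF measurable_snd mN])
  have d: "distr unit_prob2 unit_prob2 (\<lambda>(x, y). (?\<phi> x, ?\<phi> y)) = unit_prob2"
    using pair_measure_distr[OF mN mN] unit_prob.sigma_finite_measure by (simp add: distr_extend_bijection[OF \<phi>])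
  have g': "(\<lambda>p. ?g ((\<lambda>(x, y). (?\<phi> x, ?\<phi> y)) p)) \<in> borel_measurable borel"
  proof (rule measurable_compose[OF _ g])
    have "(\<lambda>(x, y). (?\<phi> x, ?\<phi> y)) \<in> measurable (borel \<Otimes>\<^sub>M borel) (borel \<Otimes>\<^sub>M borel)"
      unfolding split_beta'
      by (intro measurable_Pair measurable_compose[OF measurable_fst m] measurable_compose[OF measurable_snd m])
    then show "(\<lambda>(x, y). (?\<phi> x, ?\<phi> y)) \<in> borel_measurable borel" unfolding borel_prod .
  qed
  have "(\<integral>p. ?h p \<partial>unit_prob2) = (\<integral>p. ?h ((\<lambda>(x, y). (?\<phi> x, ?\<phi> y)) p) \<partial>unit_prob2)"
    using integral_distr[OF mp h] unfolding d .
  also have "\<dots> = (\<integral>p. indicator (?S \<times> ?T) p * ?g ((\<lambda>(x, y). (?\<phi> x, ?\<phi> y)) p) \<partial>unit_prob2)"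
    by (intro Bochner_Integration.integral_cong) (auto simp: indicator_def)
  also have "\<dots> = set_lebesgue_integral lborel (?S \<times> ?T) (\<lambda>(x, y). (P - W (\<phi> x) (\<phi> y)) $ a)"
  proof (rule rectangle_integral_eq[OF ST' g', symmetric])
    fix p :: "real \<times> real" assume "p \<in> {0..1} \<times> {0..1}"
    then show "(\<lambda>(x, y). (P - W (\<phi> x) (\<phi> y)) $ a) p = ?g ((\<lambda>(x, y). (?\<phi> x, ?\<phi> y)) p)"
      using mp_bijectionsD[OF \<phi>, of "fst p"] mp_bijectionsD[OF \<phi>, of "snd p"]
      by (auto simp: split_beta' mem_Times_iff extend_bijection_def V graphon_extension_def)
  qed
  also have "\<bar>\<dots>\<bar> \<le> cut_norm (\<lambda>x y. (P - W (\<phi> x) (\<phi> y)) $ a)"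
    by (rule cut_norm_upper[OF _ ST'])
       (intro simplex3_diff_le[OF P] graphonsD[OF W] mp_bijectionsD[OF \<phi>])
  also have "\<dots> \<le> cut_norm3 (\<lambda>x y. P - W (\<phi> x) (\<phi> y))"
    unfolding cut_norm3_def
  proof (rule member_le_sum)
    fix b :: 3
    show "0 \<le> cut_norm (\<lambda>x y. (P - W (\<phi> x) (\<phi> y)) $ b)"
      by (rule cut_norm_nonneg) (intro simplex3_diff_le[OF P] graphonsD[OF W] mp_bijectionsD[OF \<phi>])
  qed auto
  finally show ?thesis .
qed

lemma const_graphon: "P \<in> simplex3 \<Longrightarrow> (\<lambda>x y. P) \<in> graphons"
  by (simp add: graphons_def split_beta')

text \<open>Distance zero fixes the integral of each component over every rectangle. Rectangles
  determine a measure on the product, so the component and the constant are densities of the same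
  measure and agree almost everywhere.\<close>

lemma AE_eq_const_of_cut_dist_eq_0:
  assumes P: "P \<in> simplex3" and W: "W \<in> graphons" and V: "V = graphon_extension W"
    and 0: "cut_dist (\<lambda>x y. P) W = 0"
  shows "AE p in unit_prob2. (\<lambda>(x, y). V x y) p = P"
proof -
  have t: "total_graphon V" using total_graphon_extension[OF W] V by simp
  have "AE p in unit_prob2. (\<lambda>(x, y). V x y) p $ a = P $ a" for a
  proof -
    let ?v = "\<lambda>(x, y). V x y $ a"
    have v: "?v \<in> borel_measurable unit_prob2"
      using measurable_compose[OF total_graphon_triple_measurable(4)[OF t] borel_measurable_nth[of a]]
      by (simp add: split_beta')
    have vb: "0 \<le> ?v p" "?v p \<le> 1" for p
      using simplex3D(1,2)[OF total_graphonD(1)[OF t]] by (auto split: prod.splits)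
    have iv: "integrable unit_prob2 (\<lambda>p. indicator X p * ?v p)" if X: "X \<in> sets unit_prob2" for X
    proof (rule unit_prob2.integrable_const_bound[where B = 1])
      show "(\<lambda>p. indicator X p * ?v p) \<in> borel_measurable unit_prob2"
        using X v by (intro borel_measurable_times borel_measurable_indicator)
    qed (use vb in \<open>auto simp: abs_mult indicator_def intro!: AE_I2\<close>)
    have small: "(\<integral>p. indicator (S \<times> T) p * ?v p \<partial>unit_prob2) = P $ a * unit_prob2.P.prob (S \<times> T)"
      if ST: "S \<in> sets borel" "T \<in> sets borel" "S \<subseteq> {0..1}" "T \<subseteq> {0..1}" for S T
    proof -
      have X: "S \<times> T \<in> sets unit_prob2" using ST by (intro pair_measureI) auto
      have "\<bar>\<integral>p. indicator (S \<times> T) p * (\<lambda>(x, y). (P - V x y) $ a) p \<partial>unit_prob2\<bar> \<le> cut_dist (\<lambda>x y. P) W"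
        unfolding cut_dist_def using id_mp_bijections
        by (intro cINF_greatest rectangle_integral_le_cut_norm3[OF P W V _ ST]) auto
      then have "0 = (\<integral>p. indicator (S \<times> T) p * (\<lambda>(x, y). (P - V x y) $ a) p \<partial>unit_prob2)"
        using 0 by simp
      also have "\<dots> = (\<integral>p. P $ a * indicator (S \<times> T) p - indicator (S \<times> T) p * ?v p \<partial>unit_prob2)"
        by (intro Bochner_Integration.integral_cong) (auto simp: algebra_simps split: prod.splits)
      also have "\<dots> = P $ a * unit_prob2.P.prob (S \<times> T) - (\<integral>p. indicator (S \<times> T) p * ?v p \<partial>unit_prob2)"
        using X iv[OF X]
        by (subst Bochner_Integration.integral_diff) (auto simp: unit_prob2.P.emeasure_eq_measure)
      finally show ?thesis by simp
    qed
    let ?M = "density unit_prob2 (\<lambda>p. ennreal (?v p))"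
    have M: "emeasure ?M (A \<times> B) = ennreal (P $ a) * (emeasure unit_prob A * emeasure unit_prob B)"
      if AB: "A \<in> sets borel" "B \<in> sets borel" for A B
    proof -
      \<comment> \<open>The cut norm tests subsets of the unit interval only, while measure
        uniqueness asks for all Borel rectangles; outside the square everything is null.\<close>
      let ?A = "A \<inter> {0..1}" and ?B = "B \<inter> {0..1}"
      have X: "A \<times> B \<in> sets unit_prob2" "?A \<times> ?B \<in> sets unit_prob2" using AB by (auto intro!: pair_measureI)
      have "emeasure ?M (A \<times> B) = (\<integral>\<^sup>+p. ennreal (?v p) * indicator (A \<times> B) p \<partial>unit_prob2)"
        using X v by (intro emeasure_density) auto
      also have "\<dots> = (\<integral>\<^sup>+p. ennreal (indicator (?A \<times> ?B) p * ?v p) \<partial>unit_prob2)"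
      proof (rule nn_integral_cong_AE)
        show "AE p in unit_prob2. ennreal (?v p) * indicator (A \<times> B) p = ennreal (indicator (?A \<times> ?B) p * ?v p)"
          using AE_unit_prob2 by eventually_elim (auto simp: indicator_def)
      qed
      also have "\<dots> = ennreal (\<integral>p. indicator (?A \<times> ?B) p * ?v p \<partial>unit_prob2)"
        by (intro nn_integral_eq_integral iv[OF X(2)]) (use vb in \<open>auto intro!: AE_I2\<close>)
      also have "\<dots> = ennreal (P $ a * unit_prob2.P.prob (?A \<times> ?B))"
        using small[of ?A ?B] AB by simp
      also have "\<dots> = ennreal (P $ a) * emeasure unit_prob2 (?A \<times> ?B)"
        using simplex3D(1)[OF P] by (simp add: ennreal_mult unit_prob2.P.emeasure_eq_measure)
      also have "emeasure unit_prob2 (?A \<times> ?B) = emeasure unit_prob ?A * emeasure unit_prob ?B"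
        using AB by (intro unit_prob.emeasure_pair_measure_Times) auto
      also have "emeasure unit_prob ?A = emeasure unit_prob A"
        using AB by (simp add: emeasure_unit_prob Int_left_commute Int_commute)
      also have "emeasure unit_prob ?B = emeasure unit_prob B"
        using AB by (simp add: emeasure_unit_prob Int_left_commute Int_commute)
      finally show ?thesis .
    qed
    \<comment> \<open>The factor \<open>P $ a\<close> is put into the first marginal, so that both
      densities can be compared with one product measure.\<close>
    let ?M1 = "density unit_prob (\<lambda>_. ennreal (P $ a))"
    have M1: "emeasure ?M1 A = ennreal (P $ a) * emeasure unit_prob A" if "A \<in> sets borel" for A
      using that by (simp add: emeasure_density_const)
    have sf: "sigma_finite_measure ?M1"
    proof -
      have "finite_measure ?M1"
        by (rule finite_measureI) (simp add: M1 ennreal_mult_eq_top_iff)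
      then show ?thesis by (rule finite_measure.axioms(1))
    qed
    have "?M1 \<Otimes>\<^sub>M unit_prob = ?M"
      by (rule pair_measure_eqI[OF sf unit_prob.sigma_finite_measure])
         (simp_all add: M M1 mult.assoc cong: sets_pair_measure_cong)
    moreover have "?M1 \<Otimes>\<^sub>M unit_prob = density unit_prob2 (\<lambda>_. ennreal (P $ a))"
      by (rule pair_measure_eqI[OF sf unit_prob.sigma_finite_measure])
         (simp_all add: M1 mult.assoc emeasure_density_const unit_prob.emeasure_pair_measure_Times pair_measureI
           cong: sets_pair_measure_cong)
    ultimately have "?M = density unit_prob2 (\<lambda>_. ennreal (P $ a))" by simp
    then have "AE p in unit_prob2. ennreal (?v p) = ennreal (P $ a)"
      using v by (intro unit_prob2.P.density_unique) auto
    then show ?thesis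
      by eventually_elim (use vb simplex3D(1)[OF P] in \<open>auto split: prod.splits\<close>)
  qed
  then show ?thesis by (simp add: vec_eq_iff AE_all_countable)
qed

lemma AE_rep_const:
  assumes P: "P \<in> simplex3"
  defines "C \<equiv> graphon_class (\<lambda>x y. P)"
  shows "C \<in> graphon_classes" "rep C \<in> graphons"
    "AE p in unit_prob2. (\<lambda>(x, y). graphon_extension (rep C) x y) p = P"
proof -
  show C: "C \<in> graphon_classes" unfolding C_def by (intro graphon_class_mem const_graphon P)
  note r = rep_graphon_class[OF C]
  show "rep C \<in> graphons" by (rule r)
  have "cut_dist (\<lambda>x y. P) W = 0" if "W \<in> C" for W
    using that by (simp add: C_def graphon_class_def cut_rel_def)
  from this[OF r(2)] show "AE p in unit_prob2. (\<lambda>(x, y). graphon_extension (rep C) x y) p = P"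
    by (rule AE_eq_const_of_cut_dist_eq_0[OF P r(1) refl])
qed

section \<open>Existence of maximizers and the two limits\<close>

lemma objective_const: "P \<in> simplex3 \<Longrightarrow> objective \<beta> (- \<kappa>) (graphon_class (\<lambda>x y. P)) = triple_energy \<beta> \<kappa> P P P / 6"
  unfolding objective_def by (rule free_energy_const[OF AE_rep_const(2) refl AE_rep_const(3)])

lemma objective_le_diagonal:
  assumes "C \<in> graphon_classes"
    and "\<forall>P\<in>simplex3. \<forall>Q\<in>simplex3. \<forall>R\<in>simplex3. triple_energy \<beta> \<kappa> P Q R \<le> triple_energy \<beta> \<kappa> X X X"
  shows "objective \<beta> (- \<kappa>) C \<le> triple_energy \<beta> \<kappa> X X X / 6"
  unfolding objective_def using rep_graphon_class(1)[OF assms(1)] assms(2) by (intro free_energy_le) auto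

text \<open>A diagonal maximum turns the pointwise upper bound into a value attained by a constant
  graphon: the supremum is a maximum, and every maximizer has exactly this value. The last claim
  tests the maximum against an optimal two-color distribution, on which the penalty
  vanishes.\<close>

lemma diagonal_maximum:
  assumes X: "X \<in> simplex3"
    and max: "\<forall>P\<in>simplex3. \<forall>Q\<in>simplex3. \<forall>R\<in>simplex3. triple_energy \<beta> \<kappa> P Q R \<le> triple_energy \<beta> \<kappa> X X X"
  shows "psi_rainbow \<beta> (- \<kappa>) = triple_energy \<beta> \<kappa> X X X / 6"
    and "maximizers \<beta> (- \<kappa>) \<noteq> {}"
    and "C \<in> maximizers \<beta> (- \<kappa>) \<Longrightarrow> objective \<beta> (- \<kappa>) C = triple_energy \<beta> \<kappa> X X X / 6"
    and "3 * ln (max_weight \<beta>) \<le> triple_energy \<beta> \<kappa> X X X"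
proof -
  let ?X = "graphon_class (\<lambda>x y. X)"
  note le = objective_le_diagonal[OF _ max]
  have X': "?X \<in> graphon_classes" "objective \<beta> (- \<kappa>) ?X = triple_energy \<beta> \<kappa> X X X / 6"
    using AE_rep_const(1)[OF X] objective_const[OF X] by auto
  show "psi_rainbow \<beta> (- \<kappa>) = triple_energy \<beta> \<kappa> X X X / 6"
    unfolding psi_rainbow_def
  proof (rule cSup_eq_maximum)
    show "triple_energy \<beta> \<kappa> X X X / 6 \<in> objective \<beta> (- \<kappa>) ` graphon_classes"
      using X' by (intro image_eqI[of _ _ ?X]) auto
  qed (use le in auto)
  have le_X: "objective \<beta> (- \<kappa>) C \<le> objective \<beta> (- \<kappa>) ?X" if "C \<in> graphon_classes" for C
    using le[OF that] by (simp only: X'(2))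
  then have "?X \<in> maximizers \<beta> (- \<kappa>)"
    using X'(1) by (auto simp: maximizers_def is_arg_max_def not_less)
  then show "maximizers \<beta> (- \<kappa>) \<noteq> {}" by blast
  show "objective \<beta> (- \<kappa>) C = triple_energy \<beta> \<kappa> X X X / 6" if "C \<in> maximizers \<beta> (- \<kappa>)"
  proof -
    have "C \<in> graphon_classes" "objective \<beta> (- \<kappa>) ?X \<le> objective \<beta> (- \<kappa>) C"
      using that X'(1) by (auto simp: maximizers_def is_arg_max_def not_less)
    then show ?thesis using le_X[of C] by (simp only: X'(2) order.antisym)
  qed
  obtain p where p: "p \<in> optimal_pairs \<beta>" using optimal_pairs_nonempty by blast
  then have "two_color_vec \<beta> p \<in> simplex3" by (simp add: optimal_pairs_iff two_color_vec_simplex3)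
  then show "3 * ln (max_weight \<beta>) \<le> triple_energy \<beta> \<kappa> X X X"
    using max triple_energy_two_color_vec[OF p, of \<kappa>] by metis
qed

lemma psi_rainbow_limit: "((\<lambda>\<kappa>. psi_rainbow \<beta> (- \<kappa>)) \<longlongrightarrow> 1 / 2 * ln (max_weight \<beta>)) at_top"
proof (rule tendstoI)
  fix e :: real assume e: "e > 0"
  show "\<forall>\<^sub>F \<kappa> in at_top. dist (psi_rainbow \<beta> (- \<kappa>)) (1 / 2 * ln (max_weight \<beta>)) < e"
    using triple_energy_max_diagonal[of \<beta>] triple_energy_upper[OF e, of \<beta>]
  proof eventually_elim
    case (elim \<kappa>)
    then obtain X where X: "X \<in> simplex3" and max: "\<forall>P\<in>simplex3. \<forall>Q\<in>simplex3. \<forall>R\<in>simplex3.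
      triple_energy \<beta> \<kappa> P Q R \<le> triple_energy \<beta> \<kappa> X X X" by blast
    have "triple_energy \<beta> \<kappa> X X X \<le> 3 * ln (max_weight \<beta>) + e" using elim(2) X by blast
    then show ?case
      using diagonal_maximum(1,4)[OF X max] e by (simp add: dist_real_def abs_if)
  qed
qed

lemma class_set_dist_limit_classes_nonneg:
  assumes "C \<in> graphon_classes"
  shows "0 \<le> class_set_dist C (limit_classes \<beta>)"
proof -
  have "0 \<le> class_dist C D" if "D \<in> limit_classes \<beta>" for D
  proof -
    have "D \<in> graphon_classes"
      using that by (auto simp: limit_classes_def two_color_graphon_eq optimal_pairs_iff
          intro!: AE_rep_const(1) two_color_vec_simplex3)
    then show ?thesis
      unfolding class_dist_def using assms by (intro cut_dist_nonneg rep_graphon_class)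
  qed
  then show ?thesis
    unfolding class_set_dist_def using optimal_pairs_nonempty
    by (intro cINF_greatest) (auto simp: limit_classes_def)
qed

lemma class_set_dist_limit_classes_le:
  assumes C: "C \<in> graphon_classes" and p: "p \<in> optimal_pairs \<beta>" and \<epsilon>: "0 < \<epsilon>"
    and prob: "unit_prob2.P.prob {(x, y). graphon_extension (rep C) x y \<notin> ball (two_color_vec \<beta> p) \<epsilon>} \<le> \<theta>"
  shows "class_set_dist C (limit_classes \<beta>) \<le> 3 * (\<epsilon> + \<theta>)"
proof -
  let ?D = "graphon_class (\<lambda>x y. two_color_vec \<beta> p)"
  have s: "two_color_vec \<beta> p \<in> simplex3" using p by (simp add: optimal_pairs_iff two_color_vec_simplex3)
  have D: "?D \<in> limit_classes \<beta>" using p by (auto simp: limit_classes_def two_color_graphon_eq)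
  have "finite (limit_classes \<beta>)" by (simp add: limit_classes_def finite_optimal_pairs)
  then have "class_set_dist C (limit_classes \<beta>) \<le> class_dist C ?D"
    unfolding class_set_dist_def using D by (intro cINF_lower bdd_below_finite) auto
  also have "\<dots> \<le> cut_norm3 (\<lambda>x y. rep C x y - rep ?D x y)"
    unfolding class_dist_def by (intro cut_dist_le_cut_norm3 rep_graphon_class C AE_rep_const s)
  also have "\<dots> \<le> 3 * (\<epsilon> + \<theta>)"
    by (rule cut_norm3_diff_le[OF rep_graphon_class(1)[OF C] refl AE_rep_const(2)[OF s] refl s AE_rep_const(3)[OF s] \<epsilon> prob])
  finally show ?thesis .
qed

text \<open>Besides the upper bound it records nonemptiness and nonnegativity, without which the
  supremum of distances could not be controlled.\<close>

lemma maximizers_near_limit: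
  assumes e: "e > 0"
  shows "\<forall>\<^sub>F \<kappa> in at_top. maximizers \<beta> (- \<kappa>) \<noteq> {} \<and>
    (\<forall>C\<in>maximizers \<beta> (- \<kappa>). 0 \<le> class_set_dist C (limit_classes \<beta>) \<and> class_set_dist C (limit_classes \<beta>) \<le> e)"
proof -
  obtain \<epsilon>0 where \<epsilon>0: "0 < \<epsilon>0" "\<And>p q P. p \<in> color_pairs \<Longrightarrow> q \<in> color_pairs \<Longrightarrow>
    P \<in> ball (two_color_vec \<beta> p) \<epsilon>0 \<Longrightarrow> P \<in> ball (two_color_vec \<beta> q) \<epsilon>0 \<Longrightarrow> p = q"
    using two_color_vec_separated[of \<beta>] by metis
  \<comment> \<open>The final bound is \<open>3 * (\<epsilon> + 2 * \<theta>)\<close>, where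
    \<open>2 * \<theta>\<close> comes from propagating the color pair; the choices make it at most
    \<open>e\<close>. The minima keep the balls separated and
    \<open>\<theta> \<le> 1\<close>.\<close>
  define \<epsilon> where "\<epsilon> = min \<epsilon>0 (e / 6)"
  define \<theta> where "\<theta> = min 1 (e / 12)"
  have \<epsilon>: "0 < \<epsilon>" "\<epsilon> \<le> \<epsilon>0" "\<epsilon> \<le> e / 6" and \<theta>: "0 < \<theta>" "\<theta> \<le> 1" "\<theta> \<le> e / 12"
    using e \<epsilon>0(1) by (auto simp: \<epsilon>_def \<theta>_def)
  have sep: "p = q" if "p \<in> color_pairs" "q \<in> color_pairs"
    "P \<in> ball (two_color_vec \<beta> p) \<epsilon>" "P \<in> ball (two_color_vec \<beta> q) \<epsilon>" for p q P
    using \<epsilon>0(2)[OF that(1,2), of P] that(3,4) \<epsilon>(2) by simp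
  obtain \<delta> where \<delta>: "\<delta> > 0" and stab: "\<forall>\<^sub>F \<kappa> in at_top. \<forall>P\<in>simplex3. \<forall>Q\<in>simplex3. \<forall>R\<in>simplex3.
    3 * ln (max_weight \<beta>) - \<delta> \<le> triple_energy \<beta> \<kappa> P Q R \<longrightarrow> near_common_color \<beta> \<epsilon> P Q R"
    using triple_energy_stability[OF \<epsilon>(1)] unfolding near_common_color_def by blast
  \<comment> \<open>Chosen after \<open>\<delta>\<close>, so that the probability of bad triples is
    at most \<open>\<eta> / \<delta> = \<theta> / 2\<close>.\<close>
  define \<eta> where "\<eta> = \<delta> * \<theta> / 2"
  have \<eta>: "0 < \<eta>" "\<eta> / \<delta> < \<theta>" using \<delta> \<theta> by (auto simp: \<eta>_def)
  show ?thesis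
    using stab triple_energy_upper[OF \<eta>(1), of \<beta>] triple_energy_max_diagonal[of \<beta>]
  proof eventually_elim
    case (elim \<kappa>)
    then obtain X where X: "X \<in> simplex3" and max: "\<forall>P\<in>simplex3. \<forall>Q\<in>simplex3. \<forall>R\<in>simplex3.
      triple_energy \<beta> \<kappa> P Q R \<le> triple_energy \<beta> \<kappa> X X X" by blast
    have "class_set_dist C (limit_classes \<beta>) \<le> e" if CM: "C \<in> maximizers \<beta> (- \<kappa>)" for C
    proof -
      have C: "C \<in> graphon_classes" using CM by (simp add: maximizers_def is_arg_max_def)
      note W = rep_graphon_class(1)[OF C]
      let ?V = "graphon_extension (rep C)"
      have lower: "3 * ln (max_weight \<beta>) / 6 \<le> hamiltonian \<beta> (- \<kappa>) (rep C) - 1 / 2 * entropy_fun (rep C)"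
        using diagonal_maximum(3)[OF X max CM] diagonal_maximum(4)[OF X max] by (simp add: objective_def)
      have "unit_prob3.P.prob (bad_triples \<beta> \<epsilon> ?V) \<le> \<eta> / \<delta>"
        by (rule prob_bad_triples_le[OF W refl \<delta> less_imp_le[OF \<eta>(1)] _ _ lower]) (use elim(1,2) in blast)+
      then have "unit_prob3.P.prob (bad_triples \<beta> \<epsilon> ?V) < \<theta>" using \<eta>(2) by simp
      then have "\<exists>p\<in>optimal_pairs \<beta>. unit_prob2.P.prob {(x, y). ?V x y \<notin> ball (two_color_vec \<beta> p) \<epsilon>} \<le> 2 * \<theta>"
        by (rule exists_common_color[OF total_graphon_extension[OF W] _ \<theta>(2)]) (use sep in blast)
      then obtain p where "p \<in> optimal_pairs \<beta>"
        "unit_prob2.P.prob {(x, y). ?V x y \<notin> ball (two_color_vec \<beta> p) \<epsilon>} \<le> 2 * \<theta>" by blast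
      from class_set_dist_limit_classes_le[OF C this(1) \<epsilon>(1) this(2)] show ?thesis
        using \<epsilon>(3) \<theta>(3) by simp
    qed
    moreover have "0 \<le> class_set_dist C (limit_classes \<beta>)" if "C \<in> maximizers \<beta> (- \<kappa>)" for C
      using that by (intro class_set_dist_limit_classes_nonneg) (simp add: maximizers_def is_arg_max_def)
    ultimately show ?case using diagonal_maximum(2)[OF X max] by blast
  qed
qed

theorem theorem3p34:
  fixes \<beta> :: "real ^ 3"
  shows "((\<lambda>\<beta>4::real. SUP C\<in>maximizers \<beta> \<beta>4. class_set_dist C (limit_classes \<beta>)) \<longlongrightarrow> 0) at_bot \<and>
    (psi_rainbow \<beta> \<longlongrightarrow> 1 / 2 * ln (Max (pair_weight \<beta> ` color_pairs))) at_bot"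
proof
  show "((\<lambda>\<beta>4::real. SUP C\<in>maximizers \<beta> \<beta>4. class_set_dist C (limit_classes \<beta>)) \<longlongrightarrow> 0) at_bot"
    \<comment> \<open>Passes to \<open>\<kappa> = - \<beta>4\<close> tending to infinity.\<close>
    unfolding filterlim_at_bot_mirror
  proof (rule tendstoI)
    fix e :: real assume "e > 0"
    then have "e / 2 > 0" by simp
    from maximizers_near_limit[OF this, of \<beta>]
    show "\<forall>\<^sub>F \<kappa> in at_top. dist (SUP C\<in>maximizers \<beta> (- \<kappa>). class_set_dist C (limit_classes \<beta>)) 0 < e"
    proof eventually_elim
      case (elim \<kappa>)
      let ?d = "\<lambda>C. class_set_dist C (limit_classes \<beta>)"
      \<comment> \<open>A member and an upper bound together make the real supremum a genuine one,
        squeezed between 0 and \<open>e / 2\<close>.\<close>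
      obtain C where C: "C \<in> maximizers \<beta> (- \<kappa>)" using elim by blast
      have bdd: "bdd_above (?d ` maximizers \<beta> (- \<kappa>))"
        using elim by (intro bdd_aboveI2[where M = "e / 2"]) blast
      have "0 \<le> ?d C" using elim C by blast
      also have "\<dots> \<le> (SUP C\<in>maximizers \<beta> (- \<kappa>). ?d C)" by (rule cSUP_upper[OF C bdd])
      finally have "0 \<le> (SUP C\<in>maximizers \<beta> (- \<kappa>). ?d C)" .
      moreover have "(SUP C\<in>maximizers \<beta> (- \<kappa>). ?d C) \<le> e / 2"
        using elim by (intro cSUP_least) blast+
      ultimately show ?case using \<open>e > 0\<close> by (simp add: dist_real_def)
    qed
  qed
  show "(psi_rainbow \<beta> \<longlongrightarrow> 1 / 2 * ln (Max (pair_weight \<beta> ` color_pairs))) at_bot"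
    unfolding filterlim_at_bot_mirror using psi_rainbow_limit by (simp add: max_weight_def)
qed

end
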